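(* Let $q\in\mathbb{Z}_{\ge 3}$ and let $\zeta,\lambda,\mu_c,a_1,a_2,v,G_q^{\mathbb{C}},\Gamma^{(1)}=\langle a_1,a_2\rangle,\Delta^{(1)}_q,\widetilde q$ be as defined in the context. (a) (i) Suppose $q\equiv 1 \pmod 2$. Then $\Gamma^{(1)}=G_q^{\mathbb{C}}$ and $\mu_{-1}\in\Gamma^{(1)}$. (ii) Suppose $q\equiv 0\pmod 4$. Then $\Gamma^{(1)}$ is a normal subgroup of index $2$ in $G_q^{\mathbb{C}}$, $\mu_{-1}\in\Gamma^{(1)}$, the group $\langle\mu_\zeta\rangle\cap\Gamma^{(1)}=\langle\mu_{\zeta^2}\rangle$ has index $2$ in $\langle\mu_\zeta\rangle$, and $$\Delta^{(1)}_q=\Gamma^{(1)}\{1\}\ \dot\cup\ \Gamma^{(1)}\{\zeta^{q-1}\}\quad\text{(disjoint union)}.$$ (iii) Suppose $q\equiv 2\pmod 4$. Then $\Gamma^{(1)}$ is a normal subgroup of index $4$ in $G_q^{\mathbb{C}}$, $\mu_{-1}\notin\Gamma^{(1)}$, the group $\langle\mu_\zeta\rangle\cap\Gamma^{(1)}=\langle\mu_{\zeta^4}\rangle$ has index $4$ in $\langle\mu_\zeta\rangle$, and $$\Delta^{(1)}_q=\Gamma^{(1)}\{1\}\ \dot\cup\ \Gamma^{(1)}\{-1\}\ \dot\cup\ \Gamma^{(1)}\{\zeta^{q-1}\}\ \dot\cup\ \Gamma^{(1)}\{-\zeta^{q-1}\}\quad\text{(disjoint union)}.$$ (b) For any $q\in\mathbb{Z}_{\ge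 3}$ the map $a_1\mapsto\widehat{a_1}$, $a_2\mapsto\widehat{a_2}$ extends to an isomorphism from the group $\Gamma^{(1)}$ to the group with presentation $$\langle\widehat{a_1},\widehat{a_2}\mid(\widehat{a_1}\widehat{a_2}\widehat{a_1}\cdots)_{[q\text{ factors}]}=(\widehat{a_2}\widehat{a_1}\widehat{a_2}\cdots)_{[q\text{ factors}]},\ (\widehat{a_1}\widehat{a_2})^{\widetilde q}=e\rangle.$$
   Context: For $q\in\mathbb{Z}_{\ge 3}$ put $\zeta:=e^{2\pi i/(2q)}$ and $\lambda:=\zeta+\overline{\zeta}=2\cos\frac{\pi}{q}\in[1,2)$. Let $V:=\begin{pmatrix}0&-1\\1&0\end{pmatrix}$, $A_1:=\begin{pmatrix}1&\lambda\\0&1\end{pmatrix}$, $A_2:=\begin{pmatrix}1&0\\-\lambda&1\end{pmatrix}$ and $G_q^{mat}:=\langle V,A_1\rangle\subset SL_2(\mathbb{Z}[\lambda])$. Let $\psi:M_{2\times1}(\mathbb{R})\to\mathbb{C}$ be the $\mathbb{R}$-linear isomorphism $\psi\begin{pmatrix}x_1\\ x_2\end{pmatrix}=x_1+\zeta^{q-1}x_2$, and for $B\in M_{2\times2}(\mathbb{R})$ let $\Psi(B):=\psi\circ(\text{left multiplication by }B)\circ\psi^{-1}\in\mathrm{End}_{\mathbb{R}}(\mathbb{C})$. For $c\in\mathbb{C}^*$ let $\mu_c:\mathbb{C}\to\mathbb{C}$, $z\mapsto cz$. Put $v:=\Psi(V)$, $a_1:=\Psi(A_1)$, $a_2:=\Psi(A_2)$,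 $G_q^{\mathbb{C}}:=\Psi(G_q^{mat})$ (this group contains $\mu_\zeta=\Psi(A_1V)$), and $\Gamma^{(1)}:=\langle a_1,a_2\rangle\subset G_q^{\mathbb{C}}$. Define $\Delta^{(1)}_q:=G_q^{\mathbb{C}}\{1\}=\psi\bigl(G_q^{mat}\cdot(1,0)^t\bigr)\subset\mathbb{C}$, where $G\{z\}$ denotes the orbit of $z$ under $G$. Define $$\widetilde q:=\begin{cases}q&\text{if }q\equiv 0\pmod 4,\\ q/2&\text{if }q\equiv 2\pmod 4,\\ 2q&\text{if }q\equiv 1\pmod 2.\end{cases}$$ The notation $(xyx\cdots)_{[q\text{ factors}]}$ denotes the alternating product with exactly $q$ factors. *)

theory Defs
  imports "HOL-Analysis.Analysis" "HOL-Algebra.Generated_Groups"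
    "HOL-Computational_Algebra.Polynomial"
begin

definition zeta :: "nat \<Rightarrow> complex" where
  "zeta q = exp (2 * of_real pi * \<i> / (2 * of_nat q))"

definition lam :: "nat \<Rightarrow> real" where
  "lam q = 2 * cos (pi / real q)"

lemma zeta_cis: "zeta q = cis (pi / real q)"
  unfolding zeta_def cis_conv_exp by (rule arg_cong[of _ _ exp]) simp

lemma of_real_lam: "complex_of_real (lam q) = zeta q + cnj (zeta q)"
  by (simp add: zeta_cis lam_def complex_eq_iff)

text \<open>The ring \<open>\<int>[\<lambda>]\<close>, as a subset of the reals, and the matrix group \<open>SL\<^sub>2(\<int>[\<lambda>])\<close>.\<close>

definition Z_lam :: "nat \<Rightarrow> real set" where
  "Z_lam q = {poly p (lam q) | p. \<forall>i. coeff p i \<in> \<int>}"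

definition SL2 :: "nat \<Rightarrow> (real^2^2) monoid" where
  "SL2 q = \<lparr>carrier = {A. det A = 1 \<and> (\<forall>i j. A $ i $ j \<in> Z_lam q)},
            mult = (**), one = mat 1\<rparr>"

definition V_mat :: "real^2^2" where
  "V_mat = vector [vector [0, -1], vector [1, 0]]"

definition A1_mat :: "nat \<Rightarrow> real^2^2" where
  "A1_mat q = vector [vector [1, lam q], vector [0, 1]]"

definition A2_mat :: "nat \<Rightarrow> real^2^2" where
  "A2_mat q = vector [vector [1, 0], vector [- lam q, 1]]"

definition Gmat :: "nat \<Rightarrow> (real^2^2) set" where
  "Gmat q = generate (SL2 q) {V_mat, A1_mat q}"

definition psi :: "nat \<Rightarrow> real^2 \<Rightarrow> complex" where
  "psi q x = of_real (x $ 1) + zeta q ^ (q - 1) * of_real (x $ 2)"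

text \<open>For \<open>q \<ge> 3\<close> the map \<open>psi q\<close> is bijective (see \<open>bij_psi\<close> below), so \<open>inv_into UNIV\<close> is its
  genuine inverse.\<close>

definition Psi :: "nat \<Rightarrow> real^2^2 \<Rightarrow> complex \<Rightarrow> complex" where
  "Psi q B = psi q \<circ> (\<lambda>x. B *v x) \<circ> inv_into UNIV (psi q)"

definition mu :: "complex \<Rightarrow> complex \<Rightarrow> complex" where
  "mu c = (\<lambda>z. c * z)"

text \<open>The group of invertible elements of \<open>End\<^sub>\<real>(\<complex>)\<close>; subgroups of it are handled as subsets
  of its carrier, and turned into groups by updating the carrier.\<close>

definition GLC :: "(complex \<Rightarrow> complex) monoid" where
  "GLC = \<lparr>carrier = {f. linear f \<and> bij f}, mult = (\<circ>), one = id\<rparr>"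

abbreviation grp :: "(complex \<Rightarrow> complex) set \<Rightarrow> (complex \<Rightarrow> complex) monoid" where
  "grp H \<equiv> GLC\<lparr>carrier := H\<rparr>"

definition a1 :: "nat \<Rightarrow> complex \<Rightarrow> complex" where
  "a1 q = Psi q (A1_mat q)"

definition a2 :: "nat \<Rightarrow> complex \<Rightarrow> complex" where
  "a2 q = Psi q (A2_mat q)"

definition GC :: "nat \<Rightarrow> (complex \<Rightarrow> complex) set" where
  "GC q = Psi q ` Gmat q"

definition Gamma1 :: "nat \<Rightarrow> (complex \<Rightarrow> complex) set" where
  "Gamma1 q = generate GLC {a1 q, a2 q}"

definition orb :: "(complex \<Rightarrow> complex) set \<Rightarrow> complex \<Rightarrow> complex set" where
  "orb H z = {g z | g. g \<in> H}"

definition Delta1 :: "nat \<Rightarrow> complex set" where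
  "Delta1 q = orb (GC q) 1"

text \<open>The index of \<open>H\<close> in \<open>G\<close>. It is \<open>0\<close> if the index is infinite, so an equation with a positive
  number includes finiteness.\<close>

definition subgroup_index :: "('a, 'b) monoid_scheme \<Rightarrow> 'a set \<Rightarrow> nat" where
  "subgroup_index G H = card (rcosets\<^bsub>G\<^esub> H)"

definition qtilde :: "nat \<Rightarrow> nat" where
  "qtilde q = (if q mod 4 = 0 then q else if q mod 4 = 2 then q div 2 else 2 * q)"

text \<open>Groups given by generators and relations. The generators are all elements of the type
  \<open>'g\<close>; in a word the letter \<open>(x, False)\<close> stands for \<open>x\<close> and \<open>(x, True)\<close> for its inverse.
  A relation is a pair of words. The group consists of the classes of words modulo the least
  congruence on words that contains the relations and cancels \<open>x x\<inverse>\<close> and \<open>x\<inverse> x\<close>.\<close>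

type_synonym 'g word = "('g \<times> bool) list"

inductive pres_cong :: "('g word \<times> 'g word) set \<Rightarrow> 'g word \<Rightarrow> 'g word \<Rightarrow> bool"
  for R :: "('g word \<times> 'g word) set" where
  refl: "pres_cong R u u"
| sym: "pres_cong R u w \<Longrightarrow> pres_cong R w u"
| trans: "pres_cong R u w \<Longrightarrow> pres_cong R w z \<Longrightarrow> pres_cong R u z"
| append: "pres_cong R u u' \<Longrightarrow> pres_cong R w w' \<Longrightarrow> pres_cong R (u @ w) (u' @ w')"
| cancel: "pres_cong R [(x, b), (x, \<not> b)] []"
| relation: "(u, w) \<in> R \<Longrightarrow> pres_cong R u w"

definition pres_class :: "('g word \<times> 'g word) set \<Rightarrow> 'g word \<Rightarrow> 'g word set" where
  "pres_class R u = {w. pres_cong R u w}"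

definition presented_group :: "('g word \<times> 'g word) set \<Rightarrow> 'g word set monoid" where
  "presented_group R =
     \<lparr>carrier = range (pres_class R),
      mult = (\<lambda>X Y. \<Union>x\<in>X. \<Union>y\<in>Y. pres_class R (x @ y)),
      one = pres_class R []\<rparr>"

definition pres_gen :: "('g word \<times> 'g word) set \<Rightarrow> 'g \<Rightarrow> 'g word set" where
  "pres_gen R x = pres_class R [(x, False)]"

datatype gen = A1hat | A2hat

definition alt_word :: "nat \<Rightarrow> 'g \<Rightarrow> 'g \<Rightarrow> 'g word" where
  "alt_word n x y = map (\<lambda>i. (if even i then x else y, False)) [0..<n]"

definition Gamma1_relations :: "nat \<Rightarrow> (gen word \<times> gen word) set" where
  "Gamma1_relations q =
     {(alt_word q A1hat A2hat, alt_word q A2hat A1hat),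
      (concat (replicate (qtilde q) [(A1hat, False), (A2hat, False)]), [])}"

lemma pres_class_eq_iff: "pres_class R u = pres_class R w \<longleftrightarrow> pres_cong R u w"
proof
  assume "pres_class R u = pres_class R w"
  moreover have "w \<in> pres_class R w"
    by (simp add: pres_class_def pres_cong.refl)
  ultimately show "pres_cong R u w"
    by (simp add: pres_class_def set_eq_iff)
next
  assume "pres_cong R u w"
  then have "pres_cong R u x \<longleftrightarrow> pres_cong R w x" for x
    by (meson pres_cong.sym pres_cong.trans)
  then show "pres_class R u = pres_class R w"
    by (simp add: pres_class_def)
qed

lemma presented_group_mult:
  "pres_class R u \<otimes>\<^bsub>presented_group R\<^esub> pres_class R w = pres_class R (u @ w)"
proof -
  have "pres_class R (x @ y) = pres_class R (u @ w)"
    if "x \<in> pres_class R u" "y \<in> pres_class R w" for x y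
  proof -
    from that have "pres_cong R (u @ w) (x @ y)"
      unfolding pres_class_def by (simp add: pres_cong.append)
    then show ?thesis
      unfolding pres_class_eq_iff by (rule pres_cong.sym)
  qed
  then have "(\<Union>x\<in>pres_class R u. \<Union>y\<in>pres_class R w. pres_class R (x @ y)) =
      (\<Union>x\<in>pres_class R u. \<Union>y\<in>pres_class R w. pres_class R (u @ w))"
    by (intro SUP_cong HOL.refl)
  moreover have "pres_class R u \<noteq> {}" "pres_class R w \<noteq> {}"
    using pres_cong.refl[of R] unfolding pres_class_def by blast+
  ultimately show ?thesis
    by (simp add: presented_group_def)
qed

lemma group_presented_group: "group (presented_group R)"
proof -
  have carrier: "carrier (presented_group R) = range (pres_class R)"
    and one: "\<one>\<^bsub>presented_group R\<^esub> = pres_class R []"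
    by (simp_all add: presented_group_def)
  show ?thesis
  proof (rule groupI)
    fix X assume "X \<in> carrier (presented_group R)"
    then obtain u where X: "X = pres_class R u"
      by (auto simp: presented_group_def)
    let ?inv = "\<lambda>u :: ('a \<times> bool) list. rev (map (\<lambda>(x, b). (x, \<not> b)) u)"
    have "pres_cong R (?inv u @ u) []"
    proof (induction u)
      case Nil
      then show ?case by (simp add: pres_cong.refl)
    next
      case (Cons l u)
      obtain x b where l: "l = (x, b)" by force
      have "pres_cong R [(x, \<not> b), (x, b)] []"
        using pres_cong.cancel[of R x "\<not> b"] by simp
      then have "pres_cong R (?inv u @ [(x, \<not> b), (x, b)] @ u) (?inv u @ [] @ u)"
        by (intro pres_cong.append pres_cong.refl)
      then have "pres_cong R (?inv (l # u) @ l # u) (?inv u @ u)"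
        by (simp add: l)
      from pres_cong.trans[OF this Cons.IH] show ?case .
    qed
    then have "pres_class R (?inv u) \<otimes>\<^bsub>presented_group R\<^esub> X = \<one>\<^bsub>presented_group R\<^esub>"
      by (simp only: X one presented_group_mult pres_class_eq_iff)
    then show "\<exists>Y\<in>carrier (presented_group R). Y \<otimes>\<^bsub>presented_group R\<^esub> X = \<one>\<^bsub>presented_group R\<^esub>"
      unfolding carrier by blast
  next
    fix X Y assume "X \<in> carrier (presented_group R)" "Y \<in> carrier (presented_group R)"
    then show "X \<otimes>\<^bsub>presented_group R\<^esub> Y \<in> carrier (presented_group R)"
      by (auto simp: carrier presented_group_mult)
  next
    fix X Y Z assume "X \<in> carrier (presented_group R)" "Y \<in> carrier (presented_group R)"
      "Z \<in> carrier (presented_group R)"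
    then show "X \<otimes>\<^bsub>presented_group R\<^esub> Y \<otimes>\<^bsub>presented_group R\<^esub> Z =
        X \<otimes>\<^bsub>presented_group R\<^esub> (Y \<otimes>\<^bsub>presented_group R\<^esub> Z)"
      by (auto simp: carrier presented_group_mult)
  next
    fix X assume "X \<in> carrier (presented_group R)"
    then show "\<one>\<^bsub>presented_group R\<^esub> \<otimes>\<^bsub>presented_group R\<^esub> X = X"
      by (auto simp: carrier one presented_group_mult)
  qed (auto simp: carrier one)
qed

lemma group_GLC: "group GLC"
proof (rule groupI)
  fix f assume "f \<in> carrier GLC"
  then have f: "linear f" "bij f" by (auto simp: GLC_def)
  then obtain g where g: "linear g" "g \<circ> f = id"
    using linear_injective_left_inverse bij_is_inj by blast
  have "g = g \<circ> (f \<circ> inv_into UNIV f)"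
    using f by (simp only: surj_iff[THEN iffD1, OF bij_is_surj] comp_id)
  also have "\<dots> = inv_into UNIV f"
    by (simp only: comp_assoc[symmetric] g(2) id_comp)
  finally have "g = inv_into UNIV f" .
  with f have "bij g"
    by (simp only: bij_imp_bij_inv)
  with g show "\<exists>g\<in>carrier GLC. g \<otimes>\<^bsub>GLC\<^esub> f = \<one>\<^bsub>GLC\<^esub>"
    by (auto simp: GLC_def)
qed (auto simp: GLC_def linear_compose bij_comp comp_assoc linear_id)

lemma bij_psi:
  assumes "q \<ge> 3"
  shows "bij (psi q)"
proof -
  define t where "t = real (q - 1) * (pi / real q)"
  have "0 < t" "t < pi"
    using assms unfolding t_def by (auto simp: field_simps)
  then have "sin t > 0"
    by (rule sin_gt_zero)
  moreover have "zeta q ^ (q - 1) = cis t"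
    by (simp only: zeta_cis Complex.DeMoivre t_def)
  ultimately have s: "Im (zeta q ^ (q - 1)) > 0"
    by simp
  show ?thesis
  proof (rule bijI)
    show "inj (psi q)"
    proof (rule injI)
      fix x y assume "psi q x = psi q y"
      then have *: "Re (psi q x) = Re (psi q y)" "Im (psi q x) = Im (psi q y)" by simp_all
      from *(2) s have "x $ 2 = y $ 2" by (simp add: psi_def)
      moreover from this *(1) have "x $ 1 = y $ 1" by (simp add: psi_def)
      ultimately show "x = y" by (simp add: vec_eq_iff forall_2)
    qed
  next
    have "\<exists>x. psi q x = w" for w
    proof -
      define t where "t = Im w / Im (zeta q ^ (q - 1))"
      show ?thesis
        using s by (intro exI[of _ "vector [Re w - t * Re (zeta q ^ (q - 1)), t]"])
          (simp add: psi_def complex_eq_iff t_def)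
    qed
    then show "surj (psi q)"
      unfolding surj_def by (blast intro: HOL.sym)
  qed
qed

lemma Z_lam_closed:
  assumes "a \<in> Z_lam q" "b \<in> Z_lam q"
  shows "a + b \<in> Z_lam q" "a * b \<in> Z_lam q"
proof -
  obtain f g where f: "a = poly f (lam q)" "\<forall>i. coeff f i \<in> \<int>"
    and g: "b = poly g (lam q)" "\<forall>i. coeff g i \<in> \<int>"
    using assms unfolding Z_lam_def by blast
  show "a + b \<in> Z_lam q"
    unfolding Z_lam_def using f g by (intro CollectI exI[of _ "f + g"]) auto
  show "a * b \<in> Z_lam q"
    unfolding Z_lam_def using f g by (intro CollectI exI[of _ "f * g"]) (auto simp: coeff_mult)
qed

lemma Z_lam_uminus:
  assumes "a \<in> Z_lam q"
  shows "- a \<in> Z_lam q"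
proof -
  obtain f where f: "a = poly f (lam q)" "\<forall>i. coeff f i \<in> \<int>"
    using assms unfolding Z_lam_def by blast
  then show ?thesis
    unfolding Z_lam_def by (intro CollectI exI[of _ "- f"]) auto
qed

lemma Z_lam_basic: "0 \<in> Z_lam q" "1 \<in> Z_lam q" "lam q \<in> Z_lam q"
proof -
  show "0 \<in> Z_lam q"
    unfolding Z_lam_def by (intro CollectI exI[of _ 0]) auto
  show "1 \<in> Z_lam q"
    unfolding Z_lam_def by (intro CollectI exI[of _ 1]) auto
  show "lam q \<in> Z_lam q"
    unfolding Z_lam_def by (intro CollectI exI[of _ "[:0, 1:]"]) (auto simp: coeff_pCons split: nat.split)
qed

lemma group_SL2: "group (SL2 q)"
proof (rule groupI)
  fix A B assume "A \<in> carrier (SL2 q)" "B \<in> carrier (SL2 q)"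
  moreover from this have "det (A ** B) = 1"
    by (simp add: SL2_def det_mul)
  moreover have "(A ** B) $ i $ j = A $ i $ 1 * B $ 1 $ j + A $ i $ 2 * B $ 2 $ j" for i j
    by (simp add: matrix_matrix_mult_def sum_2)
  ultimately show "A \<otimes>\<^bsub>SL2 q\<^esub> B \<in> carrier (SL2 q)"
    by (auto simp: SL2_def intro!: Z_lam_closed)
next
  fix A assume A: "A \<in> carrier (SL2 q)"
  define B :: "real^2^2" where
    "B = vector [vector [A $ 2 $ 2, - (A $ 1 $ 2)], vector [- (A $ 2 $ 1), A $ 1 $ 1]]"
  have "B ** A = mat 1"
    using A by (simp add: SL2_def B_def det_2 matrix_matrix_mult_def mat_def vec_eq_iff
        forall_2 sum_2 algebra_simps)
  moreover have "B \<in> carrier (SL2 q)"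
    using A by (simp add: SL2_def B_def det_2 forall_2 Z_lam_uminus mult.commute)
  ultimately show "\<exists>B\<in>carrier (SL2 q). B \<otimes>\<^bsub>SL2 q\<^esub> A = \<one>\<^bsub>SL2 q\<^esub>"
    by (auto simp: SL2_def)
next
  show "\<one>\<^bsub>SL2 q\<^esub> \<in> carrier (SL2 q)"
    by (simp add: SL2_def mat_def Z_lam_basic det_I[unfolded mat_def])
qed (auto simp: SL2_def matrix_mul_assoc)

lemma generators_in_SL2:
  "V_mat \<in> carrier (SL2 q)" "A1_mat q \<in> carrier (SL2 q)" "A2_mat q \<in> carrier (SL2 q)"
  by (simp_all add: SL2_def V_mat_def A1_mat_def A2_mat_def det_2 forall_2 Z_lam_basic
      Z_lam_uminus)

lemma Psi_A1_V:
  assumes "q \<ge> 3"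
  shows "Psi q (A1_mat q ** V_mat) = mu (zeta q)"
proof
  fix w
  define x where "x = inv_into UNIV (psi q) w"
  have w: "w = psi q x"
    unfolding x_def using bij_psi[OF assms] by (simp add: bij_is_surj surj_f_inv_f)
  have p: "zeta q * zeta q ^ (q - 1) = -1"
  proof -
    have "zeta q * zeta q ^ (q - 1) = zeta q ^ q"
      using assms by (simp flip: power_Suc)
    also have "\<dots> = cis pi"
      using assms by (simp add: zeta_cis Complex.DeMoivre)
    finally show ?thesis by simp
  qed
  have m: "(A1_mat q ** V_mat) *v x = vector [lam q * x $ 1 - x $ 2, x $ 1]"
    by (simp add: A1_mat_def V_mat_def matrix_matrix_mult_def matrix_vector_mult_def
        vec_eq_iff forall_2 sum_2)
  have n: "cnj (zeta q) = - (zeta q ^ (q - 1))"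
  proof -
    have c: "cnj (zeta q) * zeta q = 1"
      by (simp add: zeta_cis cis_cnj cis_mult)
    have "cnj (zeta q) * (zeta q * zeta q ^ (q - 1)) = zeta q ^ (q - 1)"
      by (simp only: mult.assoc[symmetric] c mult_1_left)
    then show ?thesis
      unfolding p by (metis minus_minus mult_minus1_right)
  qed
  have "Psi q (A1_mat q ** V_mat) w =
      (of_real (lam q) + zeta q ^ (q - 1)) * of_real (x $ 1) - of_real (x $ 2)"
    unfolding Psi_def o_def x_def[symmetric] m by (simp add: psi_def algebra_simps)
  also have "\<dots> = zeta q * of_real (x $ 1) + (zeta q * zeta q ^ (q - 1)) * of_real (x $ 2)"
    unfolding p by (simp add: of_real_lam n)
  also have "\<dots> = mu (zeta q) w"
    by (simp add: w psi_def mu_def algebra_simps)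
  finally show "Psi q (A1_mat q ** V_mat) w = mu (zeta q) w" .
qed

end

theory Submission
  imports Defs
begin

text \<open>Write \<open>r\<close> for the rotation by \<open>\<zeta>\<close>; then \<open>v\<^sup>2 = r\<^sup>q = - 1\<close>, \<open>a1 = r v\<inverse>\<close>, \<open>a2 = v a1 v\<inverse>\<close> and
  \<open>a1 a2 = - r\<^sup>2\<close>, so the relations hold. Conversely, the double cone spanned by \<open>1\<close> and \<open>\<zeta>\<^bsup>q - 1\<^esup>\<close> is
  mapped into itself by \<open>r\<^sup>k v\<close> for \<open>q\<close> not dividing \<open>k\<close>, and \<open>v\<close> increases the norm there; hence a
  nonempty product of such elements is never a rotation. Normal forms in the presented group (a central
  quotient of it is a free product) thus show that only powers of \<open>a1 a2\<close> act as rotations, which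
  gives the presentation and decides whether \<open>- 1\<close> lies in \<open>Gamma1\<close>. For even \<open>q\<close> the presentation
  shows that \<open>a1\<close> and \<open>a2\<close> are not conjugate in \<open>Gamma1\<close>, so \<open>\<plusminus> v\<close> is not in \<open>Gamma1\<close>, and the cosets are
  represented by powers of \<open>v\<close>. The same norm argument shows that the stabilizer of \<open>1\<close> is generated
  by \<open>a1\<close>, which makes the orbits disjoint.\<close>

subsection \<open>Homomorphisms out of presented groups\<close>

text \<open>The decisive invariant is the norm rather than the cone alone. Plain ping-pong would
  show that a normal form is not the identity; since rotations preserve the norm, strict growth
  shows that it is not a rotation, even after multiplication by arbitrary rotations on both sides.
  For this reason only the existence of normal forms is established, not their uniqueness. The
  parity of \<open>q\<close> shapes these forms. Let \<open>c\<close> be the product of the two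
  generators. For odd \<open>q\<close> the alternating word \<open>d\<close> of length
  \<open>q\<close> satisfies \<open>d d = c^q\<close> and acts as \<open>v\<close> or
  \<open>- v\<close>, the pattern of the free product \<open>Z/2 * Z/q\<close>. For even
  \<open>q\<close> the power \<open>c^(q/2)\<close> is central and the pattern is
  \<open>Z * Z/(q/2)\<close>: here the generator \<open>x\<close> has infinite order, so
  \<open>x\<close> and its inverse must both occur as letters. The number \<open>qtilde q\<close> is
  the order of \<open>- r^2\<close>, the rotation by which \<open>c\<close> acts; the second
  relation kills exactly the powers of \<open>c\<close> that act trivially.\<close>

definition word_val :: "('a, 'b) monoid_scheme \<Rightarrow> ('g \<Rightarrow> 'a) \<Rightarrow> 'g word \<Rightarrow> 'a" where
  "word_val G f w = foldr (\<lambda>(x, b) g. (if b then inv\<^bsub>G\<^esub> (f x) else f x) \<otimes>\<^bsub>G\<^esub> g) w \<one>\<^bsub>G\<^esub>"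

lemma word_val_Nil [simp]: "word_val G f [] = \<one>\<^bsub>G\<^esub>"
  by (simp add: word_val_def)

lemma word_val_Cons [simp]:
  "word_val G f ((x, b) # w) = (if b then inv\<^bsub>G\<^esub> (f x) else f x) \<otimes>\<^bsub>G\<^esub> word_val G f w"
  by (simp add: word_val_def)

context group
begin

lemma word_val_closed:
  assumes "\<And>x. f x \<in> carrier G"
  shows "word_val G f w \<in> carrier G"
  by (induction w) (use assms in auto)

lemma word_val_append:
  assumes "\<And>x. f x \<in> carrier G"
  shows "word_val G f (u @ w) = word_val G f u \<otimes> word_val G f w"
proof (induction u)
  case (Cons l u)
  then show ?case
    using assms by (cases l) (simp add: m_assoc word_val_closed)
qed (simp add: assms word_val_closed)

lemma word_val_replicate:
  assumes "\<And>x. f x \<in> carrier G"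
  shows "word_val G f (concat (replicate n w)) = word_val G f w [^] n"
  by (induction n) (simp_all add: word_val_append word_val_closed assms flip: nat_pow_Suc2)

lemma word_val_alt_word:
  assumes "\<And>x. f x \<in> carrier G"
  shows "word_val G f (alt_word (2 * m) x y) = (f x \<otimes> f y) [^] m"
    and "word_val G f (alt_word (2 * m + 1) x y) = (f x \<otimes> f y) [^] m \<otimes> f x"
proof -
  show *: "word_val G f (alt_word (2 * m) x y) = (f x \<otimes> f y) [^] m" for m
  proof (induction m)
    case 0
    show ?case by (simp add: alt_word_def)
  next
    case (Suc m)
    have "alt_word (2 * Suc m) x y = alt_word (2 * m) x y @ [(x, False), (y, False)]"
      by (simp add: alt_word_def)
    then show ?case
      by (simp add: Suc word_val_append assms)
  qed
  have "alt_word (2 * m + 1) x y = alt_word (2 * m) x y @ [(x, False)]"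
    by (simp add: alt_word_def)
  then show "word_val G f (alt_word (2 * m + 1) x y) = (f x \<otimes> f y) [^] m \<otimes> f x"
    by (simp only: * word_val_append[OF assms] word_val_Cons word_val_Nil if_False r_one[OF assms])
qed

lemma word_val_cong:
  assumes "\<And>x. f x \<in> carrier G"
    and "\<And>u w. (u, w) \<in> R \<Longrightarrow> word_val G f u = word_val G f w"
    and "pres_cong R u w"
  shows "word_val G f u = word_val G f w"
  using assms(3)
proof induction
  case (cancel x b)
  then show ?case using assms(1) by simp
qed (simp_all add: assms word_val_append)

text \<open>Von Dyck's theorem. \<open>h\<close> evaluates a chosen representative of each class,
  and \<open>word_val_cong\<close> makes the choice irrelevant.\<close>

lemma presented_group_hom_exists:
  assumes "\<And>x. f x \<in> carrier G"
    and "\<And>u w. (u, w) \<in> R \<Longrightarrow> word_val G f u = word_val G f w"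
  obtains h where "h \<in> hom (presented_group R) G" "\<And>x. h (pres_gen R x) = f x"
proof -
  define h where "h = (\<lambda>X. word_val G f (SOME w. pres_class R w = X))"
  have h: "h (pres_class R u) = word_val G f u" for u
  proof -
    have "pres_class R (SOME w. pres_class R w = pres_class R u) = pres_class R u"
      by (rule someI) (rule HOL.refl)
    then show ?thesis
      unfolding h_def by (intro word_val_cong[OF assms]) (simp_all only: pres_class_eq_iff)
  qed
  have "h \<in> hom (presented_group R) G"
  proof (rule homI)
    fix X assume "X \<in> carrier (presented_group R)"
    then show "h X \<in> carrier G"
      by (auto simp: presented_group_def h word_val_closed assms)
  next
    fix X Y assume "X \<in> carrier (presented_group R)" "Y \<in> carrier (presented_group R)"
    then obtain u w where "X = pres_class R u" "Y = pres_class R w"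
      by (auto simp: presented_group_def)
    then show "h (X \<otimes>\<^bsub>presented_group R\<^esub> Y) = h X \<otimes> h Y"
      by (simp add: presented_group_mult h word_val_append assms)
  qed
  moreover have "h (pres_gen R x) = f x" for x
    using assms by (simp add: pres_gen_def h)
  ultimately show ?thesis by (rule that)
qed

end

lemma carrier_presented_group: "carrier (presented_group R) = range (pres_class R)"
  by (simp add: presented_group_def)

lemma pres_gen_closed [simp]: "pres_gen R x \<in> carrier (presented_group R)"
  by (simp add: pres_gen_def presented_group_def)

text \<open>This turns relations between words into equations between elements of the presented
  group, so that \<open>Gamma1_relations_iff\<close> can be used there just as in
  \<open>GLC\<close>.\<close>

lemma pres_class_eq_word_val:
  "pres_class R w = word_val (presented_group R) (pres_gen R) w"
proof -
  interpret group "presented_group R" by (rule group_presented_group)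
  show ?thesis
  proof (induction w)
    case Nil
    show ?case by (simp add: presented_group_def)
  next
    case (Cons l w)
    obtain x b where l: "l = (x, b)" by force
    have letter: "pres_class R [l] = (if b then inv\<^bsub>presented_group R\<^esub> (pres_gen R x) else pres_gen R x)"
    proof (cases b)
      case True
      have "pres_class R [(x, True)] \<otimes>\<^bsub>presented_group R\<^esub> pres_gen R x = \<one>\<^bsub>presented_group R\<^esub>"
        using pres_cong.cancel[of R x True]
        by (simp add: pres_gen_def presented_group_mult) (simp add: presented_group_def pres_class_eq_iff)
      then have "inv\<^bsub>presented_group R\<^esub> (pres_gen R x) = pres_class R [(x, True)]"
        by (rule inv_equality) (simp_all add: presented_group_def pres_gen_def)
      with True show ?thesis by (simp add: l)
    qed (simp add: l pres_gen_def)
    have "pres_class R (l # w) = pres_class R [l] \<otimes>\<^bsub>presented_group R\<^esub> pres_class R w"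
      by (simp add: presented_group_mult)
    then show ?case
      by (simp add: letter Cons) (simp add: l)
  qed
qed

lemma presented_group_relation:
  "(u, w) \<in> R \<Longrightarrow>
    word_val (presented_group R) (pres_gen R) u = word_val (presented_group R) (pres_gen R) w"
  unfolding pres_class_eq_word_val[symmetric] pres_class_eq_iff by (rule pres_cong.relation)

lemma generate_pres_gen:
  "generate (presented_group R) (range (pres_gen R)) = carrier (presented_group R)"
proof
  interpret group "presented_group R" by (rule group_presented_group)
  show "generate (presented_group R) (range (pres_gen R)) \<subseteq> carrier (presented_group R)"
    by (rule generate_incl) auto
  have "word_val (presented_group R) (pres_gen R) w \<in> generate (presented_group R) (range (pres_gen R))" for w
  proof (induction w)
    case (Cons l w)
    obtain x b where l: "l = (x, b)" by force
    have "(if b then inv\<^bsub>presented_group R\<^esub> (pres_gen R x) else pres_gen R x)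
        \<in> generate (presented_group R) (range (pres_gen R))"
      by (auto intro: generate.incl generate.inv)
    then show ?case
      unfolding l word_val_Cons by (rule generate.eng) (rule Cons)
  qed (simp add: generate.one)
  then show "carrier (presented_group R) \<subseteq> generate (presented_group R) (range (pres_gen R))"
    by (auto simp: carrier_presented_group pres_class_eq_word_val)
qed

subsection \<open>Rotations and the double cone\<close>

text \<open>The index matters only modulo \<open>2 * q\<close>; \<open>rot q (int q)\<close> is the
  central \<open>- 1\<close>. With integer indices, equations between rotations become divisibility
  statements.\<close>

definition rot :: "nat \<Rightarrow> int \<Rightarrow> complex \<Rightarrow> complex" where
  "rot q k = mu (cis (of_int k * pi / of_nat q))"

definition vmap :: "nat \<Rightarrow> complex \<Rightarrow> complex" where
  "vmap q = Psi q V_mat"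

text \<open>Up to a positive factor, \<open>ht q z\<close> is the product of the two coordinates of \<open>z\<close> with respect to
  \<open>psi q\<close>; it is positive exactly on the open double cone spanned by \<open>1\<close> and \<open>\<zeta>\<^bsup>q - 1\<^esup>\<close>.\<close>

definition ht :: "nat \<Rightarrow> complex \<Rightarrow> real" where
  "ht q z = Im z * Im (zeta q * z)"

definition pingpong :: "nat \<Rightarrow> (complex \<Rightarrow> complex) \<Rightarrow> bool" where
  "pingpong q f \<longleftrightarrow> (\<forall>z. 0 < ht q z \<longrightarrow> 0 < ht q (f z) \<and> cmod z < cmod (f z))"

lemma zeta_power_pred:
  assumes "q \<ge> 3"
  shows "zeta q ^ (q - 1) = - cnj (zeta q)"
proof -
  have "zeta q ^ (q - 1) = cis (pi - pi / real q)"
    using assms by (simp add: zeta_cis Complex.DeMoivre field_simps)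
  then show ?thesis
    by (simp add: zeta_cis complex_eq_iff)
qed

lemma psi_alt: "q \<ge> 3 \<Longrightarrow> psi q x = of_real (x $ 1) - cnj (zeta q) * of_real (x $ 2)"
  unfolding psi_def by (simp only: zeta_power_pred minus_mult_left diff_conv_add_uminus)

lemma Psi_psi: "q \<ge> 3 \<Longrightarrow> Psi q B (psi q x) = psi q (B *v x)"
  by (simp add: Psi_def bij_psi bij_is_inj)

lemma psi_cases:
  assumes "q \<ge> 3"
  obtains x where "z = psi q x"
  using bij_psi[OF assms] by (metis bij_pointE)

lemma linear_psi: "linear (psi q)"
  by (rule linearI) (simp_all add: psi_def algebra_simps, simp add: scaleR_conv_of_real algebra_simps)


lemma linear_Psi:
  assumes "q \<ge> 3"
  shows "linear (Psi q B)"
proof (rule linearI)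
  fix z w :: complex and r :: real
  obtain x y where xy: "z = psi q x" "w = psi q y"
    using psi_cases[OF assms] by metis
  show "Psi q B (z + w) = Psi q B z + Psi q B w"
    unfolding xy linear_add[OF linear_psi, symmetric] Psi_psi[OF assms] matrix_vector_right_distrib ..
  show "Psi q B (r *\<^sub>R z) = r *\<^sub>R Psi q B z"
    unfolding xy linear_cmul[OF linear_psi, symmetric] Psi_psi[OF assms] matrix_vector_mult_scaleR ..
qed

lemma Psi_mult:
  assumes "q \<ge> 3"
  shows "Psi q (A ** B) = Psi q A \<circ> Psi q B"
proof
  fix z
  obtain x where "z = psi q x" using psi_cases[OF assms] .
  then show "Psi q (A ** B) z = (Psi q A \<circ> Psi q B) z"
    by (simp add: Psi_psi[OF assms] matrix_vector_mul_assoc)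
qed

lemma Psi_one: "q \<ge> 3 \<Longrightarrow> Psi q (mat 1) = id"
  by (metis Psi_psi eq_id_iff matrix_vector_mul_lid psi_cases)

lemma Psi_hom:
  assumes "q \<ge> 3"
  shows "Psi q \<in> hom (SL2 q) GLC"
proof (rule homI)
  fix A assume A: "A \<in> carrier (SL2 q)"
  let ?B = "inv\<^bsub>SL2 q\<^esub> A"
  have "?B ** A = mat 1" "A ** ?B = mat 1"
    using group.l_inv[OF group_SL2 A] group.r_inv[OF group_SL2 A] by (simp_all add: SL2_def)
  then have "Psi q ?B \<circ> Psi q A = id" "Psi q A \<circ> Psi q ?B = id"
    by (simp_all add: Psi_one assms flip: Psi_mult[OF assms])
  then have "bij (Psi q A)" by (rule o_bij)
  then show "Psi q A \<in> carrier GLC"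
    by (simp add: GLC_def linear_Psi assms)
qed (simp add: Psi_mult[OF assms] SL2_def GLC_def)

section \<open>Rotations, \<open>v\<close> and the generators inside \<open>GLC\<close>\<close>

interpretation GLC: group GLC by (rule group_GLC)

lemma mult_GLC [simp]: "f \<otimes>\<^bsub>GLC\<^esub> g = f \<circ> g"
  by (simp add: GLC_def)

lemma one_GLC [simp]: "\<one>\<^bsub>GLC\<^esub> = id"
  by (simp add: GLC_def)

lemma GLC_comp_closed: "f \<in> carrier GLC \<Longrightarrow> g \<in> carrier GLC \<Longrightarrow> f \<circ> g \<in> carrier GLC"
  using GLC.m_closed by simp

lemma linear_GLC: "f \<in> carrier GLC \<Longrightarrow> linear f"
  by (simp add: GLC_def)

lemma mu_GLC:
  assumes "c \<noteq> 0"
  shows "mu c \<in> carrier GLC"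
proof -
  have "bij (mu c)"
    by (rule o_bij[of "mu (1 / c)"]) (use assms in \<open>auto simp: mu_def\<close>)
  moreover have "linear (mu c)"
    unfolding mu_def by (rule linearI) (simp_all add: algebra_simps)
  ultimately show ?thesis
    by (simp add: GLC_def)
qed

lemma rot_GLC [simp]: "rot q k \<in> carrier GLC"
  by (simp add: rot_def mu_GLC)

lemma vmap_GLC [simp]: "q \<ge> 3 \<Longrightarrow> vmap q \<in> carrier GLC"
  unfolding vmap_def by (rule hom_in_carrier[OF Psi_hom generators_in_SL2(1)])

lemma rot_comp: "rot q j \<circ> rot q k = rot q (j + k)"
proof -
  have "cis (real_of_int j * pi / real q) * cis (real_of_int k * pi / real q)
      = cis (real_of_int (j + k) * pi / real q)"
    by (simp add: cis_mult algebra_simps add_divide_distrib)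
  then show ?thesis
    unfolding rot_def mu_def by (simp add: fun_eq_iff flip: mult.assoc)
qed

lemma rot_comp_assoc: "rot q j \<circ> (rot q k \<circ> f) = rot q (j + k) \<circ> f"
  by (simp add: rot_comp flip: comp_assoc)

lemma rot_0 [simp]: "rot q 0 = id"
  by (simp add: rot_def mu_def fun_eq_iff)

lemma norm_rot [simp]: "cmod (rot q k z) = cmod z"
  by (simp add: rot_def mu_def norm_mult)

lemma rot_q: "q > 0 \<Longrightarrow> rot q (int q) = mu (-1)"
  by (simp add: rot_def)

lemma rot_q_z: "q > 0 \<Longrightarrow> rot q (int q) z = - z"
  by (simp add: rot_q mu_def)

lemma rot_1: "rot q 1 = mu (zeta q)"
  by (simp add: rot_def zeta_cis)

lemma rot_nat: "rot q (int k) = mu (zeta q ^ k)"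
  by (simp add: rot_def zeta_cis Complex.DeMoivre)

lemma rot_eq_id_iff:
  assumes "q > 0"
  shows "rot q k = id \<longleftrightarrow> 2 * int q dvd k"
proof
  assume "rot q k = id"
  then have "rot q k 1 = 1" by simp
  then have "cis (of_int k * pi / real q) = 1"
    by (simp add: rot_def mu_def)
  then have "cos (of_int k * pi / real q) = 1" by (simp add: complex_eq_iff)
  then obtain n :: int where "real_of_int k * pi / real q = of_int n * 2 * pi"
    using cos_one_2pi_int by blast
  then have "real_of_int k = real q * (2 * of_int n)"
    using assms by (simp add: field_simps)
  also have "\<dots> = of_int (int q * (2 * n))" by simp
  finally have "k = int q * (2 * n)" by linarith
  then show "2 * int q dvd k" by simp
next
  assume "2 * int q dvd k"
  then obtain n where "k = 2 * int q * n" ..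
  then have "rot q k = mu (cis (2 * pi * of_int n))"
    using assms by (simp add: rot_def mult_ac)
  also have "\<dots> = id"
    by (simp add: mu_def complex_eq_iff fun_eq_iff)
  finally show "rot q k = id" .
qed

lemma rot_eq_iff:
  assumes "q > 0"
  shows "rot q j = rot q k \<longleftrightarrow> 2 * int q dvd j - k"
proof -
  have "rot q j = rot q k \<longleftrightarrow> rot q (- k) \<circ> rot q j = id"
  proof
    assume "rot q (- k) \<circ> rot q j = id"
    then have "rot q k \<circ> (rot q (- k) \<circ> rot q j) = rot q k" by simp
    then show "rot q j = rot q k" by (simp add: rot_comp_assoc rot_comp)
  qed (simp add: rot_comp)
  then show ?thesis
    by (simp add: rot_comp rot_eq_id_iff assms)
qed

lemma rot_cong: "q > 0 \<Longrightarrow> 2 * int q dvd j - k \<Longrightarrow> rot q j = rot q k"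
  by (simp add: rot_eq_iff)

lemma vmap_psi:
  assumes "q \<ge> 3"
  shows "vmap q (psi q x) = - of_real (x $ 2) - cnj (zeta q) * of_real (x $ 1)"
  unfolding vmap_def Psi_psi[OF assms] unfolding psi_alt[OF assms] by (simp add: V_mat_def matrix_vector_mult_def sum_2)

lemma vmap_vmap:
  assumes "q \<ge> 3"
  shows "vmap q \<circ> vmap q = rot q (int q)"
proof -
  have "V_mat ** V_mat = - mat 1"
    by (simp add: V_mat_def matrix_matrix_mult_def mat_def vec_eq_iff forall_2 sum_2)
  then have *: "vmap q \<circ> vmap q = Psi q (- mat 1)"
    unfolding vmap_def Psi_mult[OF assms, symmetric] by simp
  have "Psi q (- mat 1) z = - z" for z
  proof -
    obtain x where x: "z = psi q x" using psi_cases[OF assms] .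
    have "(- mat 1) *v x = - x"
      by (simp add: matrix_vector_mult_def mat_def vec_eq_iff forall_2 sum_2)
    then show ?thesis
      unfolding x Psi_psi[OF assms] by (simp add: linear_neg[OF linear_psi])
  qed
  then show ?thesis
    using assms by (simp add: * rot_q_z fun_eq_iff)
qed

lemma rot_q_comm:
  assumes "q > 0" "linear f"
  shows "f \<circ> rot q (int q) = rot q (int q) \<circ> f"
  using assms by (simp add: fun_eq_iff rot_q_z linear_neg)

text \<open>By \<open>Psi_A1_V\<close>, \<open>a1 q\<close> is \<open>rot q 1\<close> times the
  inverse of \<open>v\<close>. That inverse is \<open>- v\<close>, hence the index
  \<open>int q + 1\<close>.\<close>

lemma a1_alt:
  assumes "q \<ge> 3"
  shows "a1 q = rot q (int q + 1) \<circ> vmap q"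
proof -
  have "Psi q (A1_mat q ** V_mat) = a1 q \<circ> vmap q"
    by (simp add: Psi_mult[OF assms] a1_def vmap_def)
  then have *: "a1 q \<circ> vmap q = rot q 1"
    by (simp add: Psi_A1_V[OF assms] rot_1)
  have lin: "linear (a1 q)" by (simp add: a1_def linear_Psi assms)
  have "rot q 1 \<circ> vmap q = rot q (int q) \<circ> a1 q"
    using assms rot_q_comm[OF _ lin] by (simp add: comp_assoc vmap_vmap flip: *)
  then have "rot q (int q) \<circ> (rot q 1 \<circ> vmap q) = rot q (int q) \<circ> (rot q (int q) \<circ> a1 q)"
    by simp
  moreover have "rot q (int q + int q) = id"
    using assms by (simp add: rot_eq_id_iff)
  ultimately show ?thesis
    by (simp add: rot_comp_assoc)
qed

lemma a2_alt:
  assumes "q \<ge> 3"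
  shows "a2 q = vmap q \<circ> rot q (int q + 1)"
proof -
  have "A2_mat q ** V_mat = V_mat ** A1_mat q"
    by (simp add: V_mat_def A1_mat_def A2_mat_def matrix_matrix_mult_def vec_eq_iff forall_2 sum_2)
  then have "a2 q \<circ> vmap q = vmap q \<circ> a1 q"
    unfolding a2_def a1_def vmap_def Psi_mult[OF assms, symmetric] by simp
  then have "a2 q \<circ> vmap q \<circ> vmap q = vmap q \<circ> (rot q (int q + 1) \<circ> vmap q \<circ> vmap q)"
    by (simp add: a1_alt[OF assms] comp_assoc)
  then have "a2 q \<circ> rot q (int q) = vmap q \<circ> rot q (int q + 1) \<circ> rot q (int q)"
    by (simp add: vmap_vmap[OF assms] comp_assoc)
  then have "a2 q \<circ> (rot q (int q) \<circ> rot q (- int q))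
      = vmap q \<circ> rot q (int q + 1) \<circ> (rot q (int q) \<circ> rot q (- int q))"
    by (simp flip: comp_assoc)
  then show ?thesis by (simp add: rot_comp)
qed

lemma a_GLC [simp]:
  assumes "q \<ge> 3"
  shows "a1 q \<in> carrier GLC" "a2 q \<in> carrier GLC"
  using assms by (simp_all add: a1_alt a2_alt GLC_comp_closed)

lemma a1_a2: 
  assumes "q \<ge> 3"
  shows "a1 q \<circ> a2 q = rot q (int q + 2)"
proof -
  have "a1 q \<circ> a2 q = rot q (int q + 1) \<circ> (vmap q \<circ> vmap q) \<circ> rot q (int q + 1)"
    by (simp add: a1_alt a2_alt assms comp_assoc)
  also have "\<dots> = rot q (int q + 2)"
    using assms by (simp add: vmap_vmap rot_comp rot_eq_iff)
  finally show ?thesis .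
qed

lemma inv_a1:
  assumes "q \<ge> 3"
  shows "inv\<^bsub>GLC\<^esub> (a1 q) = vmap q \<circ> rot q (- 1)"
proof (rule GLC.inv_equality)
  have "vmap q \<circ> rot q (- 1) \<circ> a1 q = vmap q \<circ> (rot q (int q) \<circ> vmap q)"
    by (simp add: a1_alt assms comp_assoc rot_comp_assoc)
  also have "\<dots> = rot q (int q) \<circ> (vmap q \<circ> vmap q)"
    using assms rot_q_comm[of q "vmap q"] by (simp add: linear_GLC flip: comp_assoc)
  also have "\<dots> = id"
    using assms by (simp add: vmap_vmap rot_comp rot_eq_id_iff)
  finally show "(vmap q \<circ> rot q (- 1)) \<otimes>\<^bsub>GLC\<^esub> a1 q = \<one>\<^bsub>GLC\<^esub>" by simp
qed (use assms in \<open>simp_all add: GLC_comp_closed\<close>)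

section \<open>Growth of the norm on the double cone\<close>

lemma sin_pi_div_pos: "q \<ge> 3 \<Longrightarrow> 0 < sin (pi / real q)"
  by (rule sin_gt_zero) (simp_all add: field_simps)

lemma lam_pos:
  assumes "q \<ge> 3"
  shows "0 < lam q"
proof -
  have "pi * 2 < pi * real q" using assms by simp
  then have "pi / real q < pi / 2" using assms by (simp add: field_simps)
  then show ?thesis
    unfolding lam_def using assms by (simp add: cos_gt_zero)
qed

lemma sin_int_eq_0_iff:
  assumes "q > 0"
  shows "sin (of_int k * pi / real q) = 0 \<longleftrightarrow> int q dvd k"
proof
  assume "sin (of_int k * pi / real q) = 0"
  then obtain n :: int where "of_int k * pi / real q = of_int n * pi"
    using sin_zero_iff_int2 by blast
  then have "real_of_int k = of_int (int q * n)"
    using assms by (simp add: field_simps)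
  then have "k = int q * n" by linarith
  then show "int q dvd k" by simp
next
  assume "int q dvd k"
  then obtain n where "k = int q * n" ..
  then show "sin (of_int k * pi / real q) = 0"
    using assms sin_zero_iff_int2 by auto
qed

text \<open>The zeros of the sine are among the sampled angles, so the sign cannot change strictly
  between two neighbours: after division of \<open>k\<close> by \<open>q\<close>, both angles lie
  between \<open>m * pi\<close> and \<open>(m + 1) * pi\<close>.\<close>

lemma sin_consecutive_nonneg:
  assumes "q > 0"
  shows "0 \<le> sin (of_int k * pi / real q) * sin (of_int (k + 1) * pi / real q)"
proof -
  define m r where "m = k div int q" and "r = k mod int q"
  have r: "0 \<le> r" "r + 1 \<le> int q" and k: "k = m * int q + r"
    using assms by (auto simp: m_def r_def zless_imp_add1_zle)
  have s: "sin (of_int m * pi) = 0"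
    using sin_zero_iff_int2 by blast
  have *: "sin (of_int (m * int q + j) * pi / real q) = cos (of_int m * pi) * sin (of_int j * pi / real q)" for j
  proof -
    have "of_int (m * int q + j) * pi / real q = of_int m * pi + of_int j * pi / real q"
      using assms by (simp add: field_simps)
    then show ?thesis by (simp add: sin_add s)
  qed
  have pos: "0 \<le> sin (of_int j * pi / real q)" if "0 \<le> j" "j \<le> int q" for j
  proof (rule sin_ge_zero)
    have "real_of_int j \<le> real q" using that by linarith
    then show "of_int j * pi / real q \<le> pi"
      using assms by (simp add: field_simps)
  qed (use that in simp)
  have "sin (of_int k * pi / real q) * sin (of_int (k + 1) * pi / real q)
      = (cos (of_int m * pi))\<^sup>2 * (sin (of_int r * pi / real q) * sin (of_int (r + 1) * pi / real q))"
    unfolding k add.assoc * by (simp add: power2_eq_square)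
  also have "\<dots> \<ge> 0"
    using r by (intro mult_nonneg_nonneg pos) auto
  finally show ?thesis .
qed

lemma ht_psi:
  assumes "q \<ge> 3"
  shows "ht q (psi q x) = x $ 1 * x $ 2 * (sin (pi / real q))\<^sup>2"
  by (simp add: ht_def psi_alt assms zeta_cis algebra_simps power2_eq_square)

text \<open>In the coordinates of \<open>psi q\<close> the squared norm is
  \<open>x1^2 + x2^2 - lam q * x1 * x2\<close>. Since \<open>v\<close> sends \<open>(x1, x2)\<close>
  to \<open>(- x2, x1)\<close>, it only flips the sign of the mixed term, and \<open>ht\<close>
  measures that term.\<close>

lemma norm_vmap:
  assumes "q \<ge> 3"
  shows "(cmod (vmap q z))\<^sup>2 = (cmod z)\<^sup>2 + 2 * lam q / (sin (pi / real q))\<^sup>2 * ht q z"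
proof -
  obtain x where x: "z = psi q x" using psi_cases[OF assms] .
  have s: "sin (pi / real q) \<noteq> 0" using sin_pi_div_pos[OF assms] by simp
  have "(cmod (vmap q z))\<^sup>2 - (cmod z)\<^sup>2 = 2 * lam q * (x $ 1 * x $ 2)"
  proof -
    define C S where "C = cos (pi / real q)" and "S = sin (pi / real q)"
    have CS: "S\<^sup>2 = 1 - C\<^sup>2" by (simp add: C_def S_def sin_squared_eq)
    have "(cmod (vmap q z))\<^sup>2 = (x $ 2 + C * x $ 1)\<^sup>2 + S\<^sup>2 * (x $ 1)\<^sup>2"
      unfolding x vmap_psi[OF assms] cmod_power2
      by (simp add: zeta_cis C_def S_def algebra_simps power2_eq_square)
    moreover have "(cmod z)\<^sup>2 = (x $ 1 - C * x $ 2)\<^sup>2 + S\<^sup>2 * (x $ 2)\<^sup>2"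
      unfolding x psi_alt[OF assms] cmod_power2
      by (simp add: zeta_cis C_def S_def algebra_simps power2_eq_square)
    ultimately show ?thesis
      unfolding CS lam_def C_def[symmetric] by (simp add: algebra_simps power2_eq_square)
  qed
  moreover have "2 * lam q / (sin (pi / real q))\<^sup>2 * ht q z = 2 * lam q * (x $ 1 * x $ 2)"
    unfolding x ht_psi[OF assms] using s by simp
  ultimately show ?thesis by linarith
qed

text \<open>In the coordinates of \<open>z\<close>, \<open>ht\<close> of the image is a quadratic
  form. Its square coefficients are products of neighbouring sines, hence nonnegative; the mixed one
  has the right sign once \<open>s k\<close> is nonzero, that is, once \<open>q\<close> does not
  divide \<open>k\<close>. The weak version serves the stabilizer of \<open>1\<close>, the strict
  one the normal forms.\<close>

lemma ht_rot_vmap: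
  assumes "q \<ge> 3"
  shows "0 \<le> ht q z \<Longrightarrow> \<not> int q dvd k \<Longrightarrow> 0 \<le> ht q (rot q k (vmap q z))"
    and "0 < ht q z \<Longrightarrow> \<not> int q dvd k \<Longrightarrow> 0 < ht q (rot q k (vmap q z))"
proof -
  obtain x where x: "z = psi q x" using psi_cases[OF assms] .
  define s where "s = (\<lambda>j::int. sin (of_int j * pi / real q))"
  have S: "sin (pi / real q) > 0" using sin_pi_div_pos[OF assms] .
  have rv: "rot q k (vmap q z) = - (of_real (x $ 2) * cis (of_int k * pi / real q)
      + of_real (x $ 1) * cis (of_int (k - 1) * pi / real q))"
  proof -
    have "cis (of_int (k - 1) * pi / real q) = cis (of_int k * pi / real q) * cnj (zeta q)"
      by (simp add: zeta_cis cis_cnj cis_mult diff_divide_distrib left_diff_distrib)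
    then show ?thesis
      unfolding x rot_def mu_def vmap_psi[OF assms] by (simp add: algebra_simps)
  qed
  have zc: "zeta q * cis (of_int j * pi / real q) = cis (of_int (j + 1) * pi / real q)" for j
    by (simp add: zeta_cis cis_mult add_divide_distrib distrib_right add.commute)
  have zrv: "zeta q * rot q k (vmap q z) = - (of_real (x $ 2) * cis (of_int (k + 1) * pi / real q)
      + of_real (x $ 1) * cis (of_int k * pi / real q))"
    unfolding rv mult_minus_right distrib_left mult.left_commute[of "zeta q"] zc by simp
  have "ht q (rot q k (vmap q z)) = (x $ 2 * s k + x $ 1 * s (k - 1)) * (x $ 2 * s (k + 1) + x $ 1 * s k)"
    unfolding ht_def zrv unfolding rv by (simp add: s_def algebra_simps)
  then have h: "ht q (rot q k (vmap q z)) = (x $ 2)\<^sup>2 * (s k * s (k + 1)) + (x $ 1)\<^sup>2 * (s (k - 1) * s k)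
      + x $ 1 * x $ 2 * ((s k)\<^sup>2 + s (k - 1) * s (k + 1))"
    by (simp add: algebra_simps power2_eq_square)
  have a: "0 \<le> s k * s (k + 1)" and b: "0 \<le> s (k - 1) * s k"
    using sin_consecutive_nonneg[of q k] sin_consecutive_nonneg[of q "k - 1"] assms
    by (simp_all add: s_def)
  \<comment> \<open>The product of the two neighbouring products contains the factor
    \<open>(s k)^2\<close>, which can be cancelled.\<close>
  have c: "0 \<le> s (k - 1) * s (k + 1)" if "s k \<noteq> 0"
  proof -
    have "0 \<le> (s k * s (k + 1)) * (s (k - 1) * s k)" using a b by (rule mult_nonneg_nonneg)
    also have "\<dots> = (s k)\<^sup>2 * (s (k - 1) * s (k + 1))" by (simp add: power2_eq_square)
    finally show ?thesis using that by (simp add: zero_le_mult_iff)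
  qed
  show "0 < ht q (rot q k (vmap q z))" if "0 < ht q z" "\<not> int q dvd k"
  proof -
    have sk: "s k \<noteq> 0" using that assms by (simp add: s_def sin_int_eq_0_iff)
    have "0 < x $ 1 * x $ 2"
      using that S unfolding x ht_psi[OF assms] by (simp add: zero_less_mult_iff)
    moreover have "0 < (s k)\<^sup>2 + s (k - 1) * s (k + 1)"
      using sk c[OF sk] by (simp add: add_pos_nonneg)
    ultimately have "0 < x $ 1 * x $ 2 * ((s k)\<^sup>2 + s (k - 1) * s (k + 1))" by (rule mult_pos_pos)
    then show ?thesis
      unfolding h using a b by (simp add: add_nonneg_pos)
  qed
  show "0 \<le> ht q (rot q k (vmap q z))" if "0 \<le> ht q z" "\<not> int q dvd k"
  proof -
    have sk: "s k \<noteq> 0" using that assms by (simp add: s_def sin_int_eq_0_iff)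
    have "0 \<le> x $ 1 * x $ 2"
      using that S unfolding x ht_psi[OF assms] by (simp add: zero_le_mult_iff)
    moreover have "0 \<le> (s k)\<^sup>2 + s (k - 1) * s (k + 1)"
      using c[OF sk] by simp
    ultimately have "0 \<le> x $ 1 * x $ 2 * ((s k)\<^sup>2 + s (k - 1) * s (k + 1))" by (rule mult_nonneg_nonneg)
    then show ?thesis
      unfolding h using a b by simp
  qed
qed

lemma pingpong_rot_vmap:
  assumes "q \<ge> 3" "\<not> int q dvd k"
  shows "pingpong q (rot q k \<circ> vmap q)"
  unfolding pingpong_def
proof (intro allI impI conjI)
  fix z assume z: "0 < ht q z"
  then show "0 < ht q ((rot q k \<circ> vmap q) z)"
    using ht_rot_vmap(2) assms by simp
  have "(cmod z)\<^sup>2 < (cmod (vmap q z))\<^sup>2"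
    using z lam_pos[of q] sin_pi_div_pos[of q] assms by (simp add: norm_vmap)
  then show "cmod z < cmod ((rot q k \<circ> vmap q) z)"
    by (auto intro: power2_less_imp_less)
qed

lemma pingpong_comp: "pingpong q f \<Longrightarrow> pingpong q g \<Longrightarrow> pingpong q (f \<circ> g)"
  unfolding pingpong_def by (metis comp_apply less_trans)

lemma pingpong_not_rot:
  assumes "q \<ge> 3" "pingpong q f"
  shows "f \<noteq> rot q k"
proof
  assume f: "f = rot q k"
  have "0 < ht q (psi q (vector [1, 1]))"
    using sin_pi_div_pos[OF assms(1)] by (simp add: ht_psi[OF assms(1)])
  then have "cmod (psi q (vector [1, 1])) < cmod (rot q k (psi q (vector [1, 1])))"
    using assms(2) unfolding pingpong_def f by blast
  then show False by simp
qed

subsection \<open>Normal forms for the presented group\<close>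

lemma inv_rot: "inv\<^bsub>GLC\<^esub> (rot q k) = rot q (- k)"
  by (rule GLC.inv_equality) (simp_all add: rot_comp)

lemma rot_int_pow: "rot q k [^]\<^bsub>GLC\<^esub> (n :: int) = rot q (k * n)"
proof -
  have *: "rot q k [^]\<^bsub>GLC\<^esub> (m :: nat) = rot q (k * int m)" for m
    by (induction m) (simp_all add: rot_comp algebra_simps)
  show ?thesis
    by (simp add: int_pow_def2 * inv_rot)
qed

context group
begin

lemma alternating_pow_commute:
  assumes "x \<in> carrier G" "y \<in> carrier G"
  shows "x \<otimes> (y \<otimes> x) [^] (n :: nat) = (x \<otimes> y) [^] n \<otimes> x"
  by (induction n) (simp_all add: assms flip: m_assoc)

text \<open>\<open>generate\<close> closes under products of arbitrary elements. To get an induction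
  letter by letter, the claim is strengthened to "right multiplication by \<open>g\<close> preserves
  \<open>P\<close>", which composes under products.\<close>

lemma generate_right_induct:
  assumes "g \<in> generate G A" "A \<subseteq> carrier G" "P \<one>"
    and "\<And>s a. s \<in> carrier G \<Longrightarrow> P s \<Longrightarrow> a \<in> A \<Longrightarrow> P (s \<otimes> a)"
    and "\<And>s a. s \<in> carrier G \<Longrightarrow> P s \<Longrightarrow> a \<in> A \<Longrightarrow> P (s \<otimes> inv a)"
  shows "P g"
proof -
  have "\<forall>s \<in> carrier G. P s \<longrightarrow> P (s \<otimes> g)"
    using assms(1)
  proof induction
    case (eng h1 h2)
    then have "h1 \<in> carrier G" "h2 \<in> carrier G"
      using generate_in_carrier[OF assms(2)] by auto
    with eng show ?case by (simp flip: m_assoc)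
  qed (use assms in auto)
  moreover have "g \<in> carrier G"
    by (rule generate_in_carrier[OF assms(2,1)])
  ultimately show ?thesis
    using assms(3) by fastforce
qed

lemma int_pow_commute:
  assumes "a \<in> carrier G" "x \<in> carrier G" "a \<otimes> x = x \<otimes> a"
  shows "a [^] (n :: int) \<otimes> x = x \<otimes> a [^] n"
proof -
  have *: "a [^] (m :: nat) \<otimes> x = x \<otimes> a [^] m" for m
  proof (induction m)
    case (Suc m)
    have "a [^] m \<otimes> a \<otimes> x = a [^] m \<otimes> x \<otimes> a"
      using assms by (simp add: m_assoc)
    then show ?case
      using assms by (simp add: Suc m_assoc)
  qed (use assms in simp)
  have **: "inv (a [^] m) \<otimes> x = x \<otimes> inv (a [^] m)" for m :: nat
  proof -
    define b where "b = a [^] m"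
    have b: "b \<in> carrier G" using assms by (simp add: b_def)
    have "inv b \<otimes> x = inv b \<otimes> (x \<otimes> b) \<otimes> inv b"
      using assms b by (simp add: m_assoc)
    also have "\<dots> = inv b \<otimes> (b \<otimes> x) \<otimes> inv b"
      by (simp only: b_def *)
    also have "\<dots> = x \<otimes> inv b"
      using assms b by (simp flip: m_assoc)
    finally show ?thesis by (simp only: b_def)
  qed
  show ?thesis
    by (cases "n < 0") (simp_all only: int_pow_def2 if_True if_False * **)
qed

end

text \<open>The relation of length \<open>q\<close> is that of the dihedral Artin group; it is
  recorded together with a representation by \<open>a1\<close> and \<open>a2\<close>. The instance
  will be the presented group, whose second relation enters afterwards, when the kernel is
  computed.\<close>

locale braid_rep = group H for H (structure) +
  fixes q :: nat and x y :: 'a and \<pi> :: "'a \<Rightarrow> complex \<Rightarrow> complex"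
  assumes q_ge_3: "q \<ge> 3"
    and x_closed [simp]: "x \<in> carrier H" and y_closed [simp]: "y \<in> carrier H"
    and generated: "carrier H = generate H {x, y}"
    and rep: "\<pi> \<in> hom H GLC" and rep_x: "\<pi> x = a1 q" and rep_y: "\<pi> y = a2 q"
    and braid_even: "even q \<Longrightarrow> (x \<otimes> y) [^] (q div 2) = (y \<otimes> x) [^] (q div 2)"
    and braid_odd: "odd q \<Longrightarrow> (x \<otimes> y) [^] (q div 2) \<otimes> x = (y \<otimes> x) [^] (q div 2) \<otimes> y"
begin

definition c :: 'a where
  "c = x \<otimes> y"

lemma c_closed [simp]: "c \<in> carrier H"
  by (simp add: c_def)

lemma q_pos: "q > 0"
  using q_ge_3 by simp

lemma rep_mult: "g \<in> carrier H \<Longrightarrow> h \<in> carrier H \<Longrightarrow> \<pi> (g \<otimes> h) = \<pi> g \<circ> \<pi> h"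
  using hom_mult[OF rep] by simp

lemma rep_inv: "g \<in> carrier H \<Longrightarrow> \<pi> (inv g) = inv\<^bsub>GLC\<^esub> (\<pi> g)"
  by (simp add: group_hom.hom_inv group_hom.intro group_hom_axioms.intro group_GLC is_group rep)

lemma rep_c_pow: "\<pi> (c [^] (n :: int)) = rot q ((int q + 2) * n)"
proof -
  have "\<pi> c = rot q (int q + 2)"
    by (simp add: c_def rep_mult rep_x rep_y a1_a2 q_ge_3)
  then show ?thesis
    by (simp add: hom_int_pow[OF rep _ is_group group_GLC] rot_int_pow)
qed

lemma c_pow_mult: "c [^] (i :: int) \<otimes> c [^] (j :: int) = c [^] (i + j)"
  by (simp add: int_pow_mult)

lemma c_pow_mult_assoc:
  "g \<in> carrier H \<Longrightarrow> c [^] (i :: int) \<otimes> (c [^] (j :: int) \<otimes> g) = c [^] (i + j) \<otimes> g"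
  by (simp add: c_pow_mult flip: m_assoc)

text \<open>\<open>y\<close> is \<open>inv x \<otimes> c\<close> and \<open>inv y\<close> is
  \<open>inv c \<otimes> x\<close>, so \<open>c\<close> and \<open>x\<close> generate
  \<open>H\<close>. All powers of \<open>c\<close> form a single step because a normal form absorbs
  them at once.\<close>

lemma right_induct [consumes 1, case_names one c x inv_x]:
  assumes "g \<in> carrier H" "P \<one>"
    and c: "\<And>s n. s \<in> carrier H \<Longrightarrow> P s \<Longrightarrow> P (s \<otimes> c [^] (n :: int))"
    and x: "\<And>s. s \<in> carrier H \<Longrightarrow> P s \<Longrightarrow> P (s \<otimes> x)"
    and inv_x: "\<And>s. s \<in> carrier H \<Longrightarrow> P s \<Longrightarrow> P (s \<otimes> inv x)"
  shows "P g"
proof (rule generate_right_induct[of g "{x, y}" P])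
  show "g \<in> generate H {x, y}"
    using assms(1) generated by simp
  fix s a assume s: "s \<in> carrier H" "P s" and a: "a \<in> {x, y}"
  have inv_x_xy: "inv x \<otimes> (x \<otimes> y) = y"
    by (simp flip: m_assoc)
  have "P (s \<otimes> inv x \<otimes> c [^] (1 :: int))" "P (s \<otimes> c [^] (- 1 :: int) \<otimes> x)"
    using s by (intro c x inv_x; simp)+
  moreover have "s \<otimes> inv x \<otimes> c [^] (1 :: int) = s \<otimes> y" "s \<otimes> c [^] (- 1 :: int) \<otimes> x = s \<otimes> inv y"
    using s by (simp_all add: c_def m_assoc int_pow_neg inv_mult_group inv_x_xy)
  ultimately show "P (s \<otimes> a)" "P (s \<otimes> inv a)"
    using a x[OF s] inv_x[OF s] by auto
qed (use assms(2) in auto)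

text \<open>For even \<open>q\<close> every element of \<open>H\<close> is \<open>p c\<^sup>b\<close> with \<open>even_form i p\<close>. Up to sign \<open>x\<close> acts as
  \<open>r v\<close> and \<open>x\<inverse>\<close> as \<open>v r\<inverse>\<close> (\<open>r\<close> the rotation by \<open>\<zeta>\<close>); the flag \<open>i\<close> records that the last letter was
  \<open>x\<inverse>\<close>, so that one factor \<open>r\<close> is missing on the right. The side conditions exclude cancellation.\<close>

inductive even_form :: "bool \<Rightarrow> 'a \<Rightarrow> bool" where
  init: "even_form False (c [^] (a :: int))"
| pos: "even_form i p \<Longrightarrow> \<not> i \<or> \<not> int (q div 2) dvd e \<Longrightarrow> even_form False (p \<otimes> c [^] (e :: int) \<otimes> x)"
| neg: "even_form i p \<Longrightarrow> i \<or> \<not> int (q div 2) dvd e \<Longrightarrow> even_form True (p \<otimes> c [^] (e :: int) \<otimes> inv x)"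

lemma even_form_closed: "even_form i p \<Longrightarrow> p \<in> carrier H"
  by (induction rule: even_form.induct) auto

lemma rep_inv_x: "\<pi> (inv x) = vmap q \<circ> rot q (- 1)"
  by (simp add: rep_inv rep_x inv_a1 q_ge_3)

text \<open>Each letter contributes a block \<open>rot q k \<circ> vmap q\<close>, and the side
  conditions of \<open>even_form\<close> keep \<open>q\<close> from dividing \<open>k\<close>.
  Between letters of equal sign \<open>k\<close> is odd whereas \<open>q\<close> is even; between
  letters of opposite sign \<open>k\<close> is \<open>2 * e\<close> modulo \<open>q\<close>.\<close>

lemma even_form_pingpong:
  assumes "even q" "even_form i p"
  shows "(\<not> i \<and> (\<exists>a::int. p = c [^] a)) \<or> (\<exists>j. pingpong q (rot q j \<circ> \<pi> p \<circ> rot q (of_bool i)))"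
  using assms(2)
proof (induction rule: even_form.induct)
  case (init a)
  then show ?case by blast
next
  case (pos i p e)
  note [simp] = even_form_closed[OF pos(1)]
  show ?case
    using pos.IH
  proof (elim disjE conjE exE)
    fix a :: int assume p: "p = c [^] a"
    \<comment> \<open>The rotation in front is free; it is chosen so that the index \<open>1\<close>
      remains, which \<open>q\<close> does not divide.\<close>
    let ?j = "1 - ((int q + 2) * (a + e) + int q + 1)"
    have "rot q ?j \<circ> \<pi> (p \<otimes> c [^] e \<otimes> x) \<circ> rot q (of_bool False) = rot q 1 \<circ> vmap q"
      by (simp add: p c_pow_mult rep_mult rep_c_pow rep_x a1_alt q_ge_3 comp_assoc rot_comp_assoc)
    moreover have "pingpong q (rot q 1 \<circ> vmap q)"
      using q_ge_3 by (intro pingpong_rot_vmap) auto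
    ultimately show ?thesis by metis
  next
    fix j assume j: "pingpong q (rot q j \<circ> \<pi> p \<circ> rot q (of_bool i))"
    \<comment> \<open>The summand \<open>- of_bool i\<close> undoes the rotation appended to the
      right of \<open>\<pi> p\<close>.\<close>
    let ?k = "(int q + 2) * e + int q + 1 - of_bool i"
    have "\<not> int q dvd ?k"
    proof
      assume *: "int q dvd ?k"
      show False
      proof (cases i)
        case True
        have "int q dvd ?k - int q * (e + 1)"
          by (rule dvd_diff[OF *]) simp
        also have "?k - int q * (e + 1) = 2 * e"
          using True by (simp add: algebra_simps)
        finally have "int (q div 2) dvd e"
          using assms(1) by auto
        with True pos show False by simp
      next
        case False
        have "even ?k" using * assms(1) by (meson dvd_trans even_of_nat)
        with False assms(1) show False by simp
      qed
    qed
    then have "pingpong q (rot q j \<circ> \<pi> p \<circ> rot q (of_bool i) \<circ> (rot q ?k \<circ> vmap q))"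
      by (intro pingpong_comp pingpong_rot_vmap j q_ge_3)
    also have "rot q j \<circ> \<pi> p \<circ> rot q (of_bool i) \<circ> (rot q ?k \<circ> vmap q)
        = rot q j \<circ> \<pi> (p \<otimes> c [^] e \<otimes> x) \<circ> rot q (of_bool False)"
      by (simp add: rep_mult rep_c_pow rep_x a1_alt q_ge_3 comp_assoc rot_comp_assoc add.assoc)
    finally show ?thesis by blast
  qed
next
  case (neg i p e)
  note [simp] = even_form_closed[OF neg(1)]
  show ?case
    using neg.IH
  proof (elim disjE conjE exE)
    fix a :: int assume p: "p = c [^] a"
    let ?j = "1 - (int q + 2) * (a + e)"
    have "rot q ?j \<circ> \<pi> (p \<otimes> c [^] e \<otimes> inv x) \<circ> rot q (of_bool True) = rot q 1 \<circ> vmap q"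
      by (simp add: p c_pow_mult rep_mult rep_c_pow rep_inv_x q_ge_3 comp_assoc rot_comp rot_comp_assoc)
    moreover have "pingpong q (rot q 1 \<circ> vmap q)"
      using q_ge_3 by (intro pingpong_rot_vmap) auto
    ultimately show ?thesis by metis
  next
    fix j assume j: "pingpong q (rot q j \<circ> \<pi> p \<circ> rot q (of_bool i))"
    let ?k = "(int q + 2) * e - of_bool i"
    have "\<not> int q dvd ?k"
    proof
      assume *: "int q dvd ?k"
      show False
      proof (cases i)
        case False
        have "int q dvd ?k - int q * e"
          by (rule dvd_diff[OF *]) simp
        also have "?k - int q * e = 2 * e"
          using False by (simp add: algebra_simps)
        finally have "int (q div 2) dvd e"
          using assms(1) by auto
        with False neg show False by simp
      next
        case True
        have "even ?k" using * assms(1) by (meson dvd_trans even_of_nat)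
        with True assms(1) show False by simp
      qed
    qed
    then have "pingpong q (rot q j \<circ> \<pi> p \<circ> rot q (of_bool i) \<circ> (rot q ?k \<circ> vmap q))"
      by (intro pingpong_comp pingpong_rot_vmap j q_ge_3)
    also have "rot q j \<circ> \<pi> p \<circ> rot q (of_bool i) \<circ> (rot q ?k \<circ> vmap q)
        = rot q j \<circ> \<pi> (p \<otimes> c [^] e \<otimes> inv x) \<circ> rot q (of_bool True)"
      by (simp add: rep_mult rep_c_pow rep_inv_x q_ge_3 comp_assoc rot_comp rot_comp_assoc)
    finally show ?thesis by blast
  qed
qed

text \<open>Regrouping gives \<open>c^(q/2) x = x (y x)^(q/2)\<close>, and the relation for even
  \<open>q\<close> replaces \<open>(y x)^(q/2)\<close> by \<open>c^(q/2)\<close>.\<close>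

lemma c_pow_x_commute:
  assumes "even q" "int (q div 2) dvd b"
  shows "c [^] b \<otimes> x = x \<otimes> c [^] b"
proof -
  obtain n where b: "b = int (q div 2) * n" using assms(2) ..
  have "c [^] (q div 2) \<otimes> x = x \<otimes> c [^] (q div 2)"
    using alternating_pow_commute[of x y "q div 2"] braid_even[OF assms(1)] by (simp add: c_def)
  then have "(c [^] (q div 2)) [^] n \<otimes> x = x \<otimes> (c [^] (q div 2)) [^] n"
    by (rule int_pow_commute[rotated 2]) auto
  moreover have "(c [^] (q div 2)) [^] n = c [^] b"
    unfolding b by (simp add: int_pow_pow flip: int_pow_int)
  ultimately show ?thesis by simp
qed

text \<open>A letter can be appended unless it is inverse to the last one and the power of
  \<open>c\<close> in between commutes with \<open>x\<close>; in that case the two letters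
  cancel.\<close>

lemma even_form_exists:
  assumes "even q" "g \<in> carrier H"
  shows "\<exists>i p b. even_form i p \<and> g = p \<otimes> c [^] (b :: int)"
  using assms(2)
proof (induction rule: right_induct)
  case one
  show ?case
    using init[of 0] by (intro exI[of _ False] exI[of _ \<one>] exI[of _ "0 :: int"]) simp
next
  case (c s n)
  then obtain i p b where p: "even_form i p" and s: "s = p \<otimes> c [^] (b :: int)" by blast
  have "s \<otimes> c [^] n = p \<otimes> c [^] (b + n)"
    using even_form_closed[OF p] by (simp add: s m_assoc c_pow_mult)
  with p show ?case by blast
next
  case (x s)
  then obtain i p b where p: "even_form i p" and s: "s = p \<otimes> c [^] (b :: int)" by blast
  have [simp]: "p \<in> carrier H" by (rule even_form_closed[OF p])
  show ?case
  proof (cases "\<not> i \<or> \<not> int (q div 2) dvd b")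
    case True
    then have "even_form False (p \<otimes> c [^] b \<otimes> x)"
      by (rule pos[OF p])
    moreover have "s \<otimes> x = p \<otimes> c [^] b \<otimes> x \<otimes> c [^] (0 :: int)"
      by (simp add: s)
    ultimately show ?thesis by blast
  next
    case False
    with p obtain i' p' e where p': "even_form i' p'" and pe: "p = p' \<otimes> c [^] (e :: int) \<otimes> inv x"
      by (cases rule: even_form.cases) auto
    have [simp]: "p' \<in> carrier H" by (rule even_form_closed[OF p'])
    have "s \<otimes> x = p \<otimes> x \<otimes> c [^] b"
      using False c_pow_x_commute[OF assms(1), of b] by (simp add: s m_assoc)
    also have "\<dots> = p' \<otimes> c [^] (e + b)"
      by (simp add: pe m_assoc c_pow_mult)
    finally show ?thesis using p' by blast
  qed
next
  case (inv_x s)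
  then obtain i p b where p: "even_form i p" and s: "s = p \<otimes> c [^] (b :: int)" by blast
  have [simp]: "p \<in> carrier H" by (rule even_form_closed[OF p])
  show ?case
  proof (cases "i \<or> \<not> int (q div 2) dvd b")
    case True
    then have "even_form True (p \<otimes> c [^] b \<otimes> inv x)"
      by (rule neg[OF p])
    moreover have "s \<otimes> inv x = p \<otimes> c [^] b \<otimes> inv x \<otimes> c [^] (0 :: int)"
      by (simp add: s)
    ultimately show ?thesis by blast
  next
    case False
    then have comm: "c [^] b \<otimes> inv x = inv x \<otimes> c [^] b"
      using int_pow_commute[of x "c [^] b" "- 1"] c_pow_x_commute[OF assms(1), of b]
      by (simp add: int_pow_neg)
    from p False consider a where "p = c [^] (a :: int)"
      | i' p' e where "even_form i' p'" "p = p' \<otimes> c [^] (e :: int) \<otimes> x"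
      by (cases rule: even_form.cases) auto
    then show ?thesis
    proof cases
      \<comment> \<open>There is no earlier letter to cancel with, yet \<open>neg\<close> demands an
        exponent not divisible by \<open>q div 2\<close>. The power of \<open>c\<close> is split so
        that this exponent is \<open>1\<close>; note that \<open>q div 2\<close> is at least
        \<open>2\<close>.\<close>
      case (1 a)
      have "\<not> q div 2 dvd 1" using q_ge_3 assms(1) by (auto elim!: evenE)
      then have "even_form True (c [^] (a + b - 1) \<otimes> c [^] (1 :: int) \<otimes> inv x)"
        by (intro neg[OF init]) (metis int_dvd_int_iff of_nat_1)
      moreover have "s \<otimes> inv x = c [^] (a + b - 1) \<otimes> c [^] (1 :: int) \<otimes> inv x \<otimes> c [^] (0 :: int)"
        unfolding s 1 c_pow_mult by simp
      ultimately show ?thesis by blast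
    next
      case (2 i' p' e)
      have [simp]: "p' \<in> carrier H" by (rule even_form_closed[OF 2(1)])
      have "s \<otimes> inv x = p \<otimes> inv x \<otimes> c [^] b"
        using comm by (simp add: s m_assoc)
      also have "\<dots> = p' \<otimes> c [^] (e + b)"
        by (simp add: 2 m_assoc c_pow_mult)
      finally show ?thesis using 2 by blast
    qed
  qed
qed

text \<open>For odd \<open>q\<close> this is the alternating product of length \<open>q\<close>, the
  Garside element of the dihedral Artin group. The index in \<open>rep_d\<close> is then a multiple
  of \<open>q\<close>, so \<open>d\<close> acts as \<open>v\<close> or \<open>- v\<close>.\<close>

definition d :: 'a where
  "d = c [^] (q div 2) \<otimes> x"

text \<open>For odd \<open>q\<close> the inverse of \<open>d\<close> is \<open>d\<close> times a
  central power of \<open>c\<close>. Hence one letter suffices, and two letters can merge only if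
  \<open>q\<close> divides the exponent between them.\<close>

inductive odd_form :: "'a \<Rightarrow> bool" where
  init: "odd_form (c [^] (a :: int))"
| step: "odd_form p \<Longrightarrow> \<not> int q dvd e \<Longrightarrow> odd_form (p \<otimes> c [^] (e :: int) \<otimes> d)"

lemma d_closed [simp]: "d \<in> carrier H"
  by (simp add: d_def)

lemma odd_form_closed: "odd_form p \<Longrightarrow> p \<in> carrier H"
  by (induction rule: odd_form.induct) auto

lemma rep_d: "\<pi> d = rot q ((int q + 2) * int (q div 2) + int q + 1) \<circ> vmap q"
proof -
  have "d = c [^] int (q div 2) \<otimes> x" by (simp add: d_def int_pow_int)
  then show ?thesis
    by (simp add: rep_mult rep_c_pow rep_x a1_alt q_ge_3 rot_comp_assoc add.assoc)
qed

lemma odd_form_pingpong: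
  assumes "odd q" "odd_form p"
  shows "(\<exists>a::int. p = c [^] a) \<or> (\<exists>j. pingpong q (rot q j \<circ> \<pi> p))"
  using assms(2)
proof (induction rule: odd_form.induct)
  case (init a)
  then show ?case by blast
next
  case (step p e)
  note [simp] = odd_form_closed[OF step(1)]
  let ?m = "int (q div 2)"
  show ?case
    using step.IH
  proof (elim disjE exE)
    fix a :: int assume p: "p = c [^] a"
    let ?j = "1 - ((int q + 2) * (a + e) + (int q + 2) * ?m + int q + 1)"
    have "rot q ?j \<circ> \<pi> (p \<otimes> c [^] e \<otimes> d) = rot q 1 \<circ> vmap q"
      by (simp add: p c_pow_mult rep_mult rep_c_pow rep_d comp_assoc rot_comp_assoc)
    moreover have "pingpong q (rot q 1 \<circ> vmap q)"
      using q_ge_3 by (intro pingpong_rot_vmap) auto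
    ultimately show ?thesis by metis
  next
    fix j assume j: "pingpong q (rot q j \<circ> \<pi> p)"
    let ?k = "(int q + 2) * e + ((int q + 2) * ?m + int q + 1)"
    have "\<not> int q dvd ?k"
    proof
      assume *: "int q dvd ?k"
      have m: "int q = 2 * ?m + 1" using assms(1) by (auto elim!: oddE)
      \<comment> \<open>Since \<open>2 * ?m + 1\<close> equals \<open>q\<close>, the letter
        \<open>d\<close> contributes \<open>q * (?m + 2)\<close>, and only \<open>2 * e\<close> is
        left modulo \<open>q\<close>.\<close>
      have "int q dvd ?k - int q * (e + ?m + 2)"
        by (rule dvd_diff[OF *]) simp
      also have "?k - int q * (e + ?m + 2) = 2 * e"
        using m by (simp add: algebra_simps)
      finally have "int q dvd e"
        using assms(1) by (simp add: coprime_dvd_mult_right_iff)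
      with step show False by simp
    qed
    then have "pingpong q (rot q j \<circ> \<pi> p \<circ> (rot q ?k \<circ> vmap q))"
      by (intro pingpong_comp pingpong_rot_vmap j q_ge_3)
    also have "rot q j \<circ> \<pi> p \<circ> (rot q ?k \<circ> vmap q) = rot q j \<circ> \<pi> (p \<otimes> c [^] e \<otimes> d)"
      by (simp add: rep_mult rep_c_pow rep_d comp_assoc rot_comp_assoc)
    finally show ?thesis by blast
  qed
qed

text \<open>The relation gives \<open>d\<close> a second spelling \<open>(y x)^m y\<close>. Placed
  after the first spelling \<open>c^m x\<close>, it regroups into \<open>2 * m + 1 = q\<close>
  copies of \<open>x y\<close>.\<close>

lemma d_square:
  assumes "odd q"
  shows "d \<otimes> d = c [^] int q"
proof -
  have yx: "x \<otimes> ((y \<otimes> x) [^] n \<otimes> y) = c [^] n \<otimes> c" for n :: nat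
    using alternating_pow_commute[of x y n] by (simp add: c_def flip: m_assoc)
  have "d = (y \<otimes> x) [^] (q div 2) \<otimes> y"
    using braid_odd[OF assms] by (simp add: d_def c_def)
  then have "d \<otimes> d = d \<otimes> ((y \<otimes> x) [^] (q div 2) \<otimes> y)" by simp
  also have "\<dots> = c [^] (q div 2) \<otimes> (x \<otimes> ((y \<otimes> x) [^] (q div 2) \<otimes> y))"
    by (simp add: d_def m_assoc)
  also have "\<dots> = c [^] (int (q div 2) + (int (q div 2) + 1))"
    unfolding yx by (simp only: int_pow_mult c_closed int_pow_int int_pow_1)
  also have "int (q div 2) + (int (q div 2) + 1) = int q"
    using assms by (auto elim!: oddE)
  finally show ?thesis .
qed

lemma c_pow_d_commute:
  assumes "odd q" "int q dvd b"
  shows "c [^] b \<otimes> d = d \<otimes> c [^] b"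
proof -
  obtain n where b: "b = int q * n" using assms(2) ..
  have "c [^] int q \<otimes> d = d \<otimes> c [^] int q"
    by (simp add: m_assoc flip: d_square[OF assms(1)])
  then have "(c [^] int q) [^] n \<otimes> d = d \<otimes> (c [^] int q) [^] n"
    by (rule int_pow_commute[rotated 2]) auto
  then show ?thesis
    unfolding b by (simp add: int_pow_pow)
qed

lemma odd_form_exists:
  assumes "odd q" "g \<in> carrier H"
  shows "\<exists>p b. odd_form p \<and> g = p \<otimes> c [^] (b :: int)"
proof -
  define P where "P = (\<lambda>g. \<exists>p b. odd_form p \<and> g = p \<otimes> c [^] (b :: int))"
  have P_c: "P (s \<otimes> c [^] (n :: int))" if "P s" for s n
  proof -
    from that obtain p b where p: "odd_form p" and s: "s = p \<otimes> c [^] (b :: int)"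
      unfolding P_def by blast
    have "s \<otimes> c [^] n = p \<otimes> c [^] (b + n)"
      using odd_form_closed[OF p] by (simp add: s m_assoc c_pow_mult)
    with p show ?thesis unfolding P_def by blast
  qed
  have P_d: "P (s \<otimes> d)" if "P s" for s
  proof -
    from that obtain p b where p: "odd_form p" and s: "s = p \<otimes> c [^] (b :: int)"
      unfolding P_def by blast
    have [simp]: "p \<in> carrier H" by (rule odd_form_closed[OF p])
    show ?thesis
    proof (cases "int q dvd b")
      case False
      then have "odd_form (p \<otimes> c [^] b \<otimes> d)"
        by (rule step[OF p])
      moreover have "s \<otimes> d = p \<otimes> c [^] b \<otimes> d \<otimes> c [^] (0 :: int)"
        by (simp add: s)
      ultimately show ?thesis unfolding P_def by blast
    next
      case True
      from p show ?thesis
      proof (cases rule: odd_form.cases)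
        \<comment> \<open>As \<open>q\<close> divides \<open>b\<close>, the exponent before
          \<open>d\<close> has to be altered; one factor \<open>c\<close> is split off.\<close>
        case (init a)
        have "odd_form (c [^] (a + b - 1) \<otimes> c [^] (1 :: int) \<otimes> d)"
          using q_ge_3 by (intro step odd_form.init) auto
        moreover have "s \<otimes> d = c [^] (a + b - 1) \<otimes> c [^] (1 :: int) \<otimes> d \<otimes> c [^] (0 :: int)"
          unfolding s init c_pow_mult by simp
        ultimately show ?thesis unfolding P_def by blast
      next
        case (step p' e)
        have [simp]: "p' \<in> carrier H" by (rule odd_form_closed[OF step(2)])
        have "s \<otimes> d = p' \<otimes> c [^] e \<otimes> (d \<otimes> d) \<otimes> c [^] b"
          using c_pow_d_commute[OF assms(1) True] by (simp add: s step m_assoc)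
        also have "\<dots> = p' \<otimes> c [^] (e + int q + b)"
          unfolding d_square[OF assms(1)] by (simp add: m_assoc c_pow_mult add.assoc)
        finally show ?thesis unfolding P_def using step(2) by blast
      qed
    qed
  qed
  define m where "m = int (q div 2)"
  have d: "d = c [^] m \<otimes> x"
    by (simp only: d_def m_def int_pow_int)
  have x_eq: "x = c [^] (- m) \<otimes> d"
    by (simp add: d c_pow_mult_assoc)
  have inv_x_eq: "inv x = d \<otimes> c [^] (- int q + m)"
  proof (rule inv_equality)
    have "d \<otimes> c [^] (- int q + m) \<otimes> x = d \<otimes> (c [^] (- int q) \<otimes> d)"
      by (simp add: d m_assoc c_pow_mult_assoc)
    also have "\<dots> = d \<otimes> d \<otimes> c [^] (- int q)"
      using c_pow_d_commute[OF assms(1), of "- int q"] by (simp add: m_assoc)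
    also have "\<dots> = \<one>"
      by (simp only: d_square[OF assms(1)] c_pow_mult) simp
    finally show "d \<otimes> c [^] (- int q + m) \<otimes> x = \<one>" .
  qed auto
  have "P g"
    using assms(2)
  proof (induction rule: right_induct)
    case one
    show ?case
      unfolding P_def using odd_form.init[of 0] by (intro exI[of _ \<one>] exI[of _ "0 :: int"]) simp
  next
    case (x s)
    have "P (s \<otimes> c [^] (- m) \<otimes> d)" by (intro P_d P_c x)
    also have "s \<otimes> c [^] (- m) \<otimes> d = s \<otimes> (c [^] (- m) \<otimes> d)"
      using x(1) by (simp add: m_assoc)
    finally show ?case unfolding x_eq[symmetric] .
  next
    case (inv_x s)
    have "P (s \<otimes> d \<otimes> c [^] (- int q + m))" by (intro P_d P_c inv_x)
    also have "s \<otimes> d \<otimes> c [^] (- int q + m) = s \<otimes> (d \<otimes> c [^] (- int q + m))"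
      using inv_x(1) by (simp add: m_assoc)
    finally show ?case unfolding inv_x_eq[symmetric] .
  qed (rule P_c)
  then show ?thesis unfolding P_def .
qed

text \<open>The trailing power of \<open>c\<close> acts as a rotation, so if \<open>g\<close> acts
  as one, so does the form \<open>p\<close>; by \<open>pingpong_not_rot\<close> this leaves only
  powers of \<open>c\<close>. Faithfulness of the representation and the exclusion of
  \<open>- 1\<close> both rest on this passage from the action back to the abstract group.\<close>

lemma rep_rot_imp_c_pow:
  assumes g: "g \<in> carrier H" "\<pi> g = rot q k"
  obtains n :: int where "g = c [^] n"
proof -
  have "\<exists>n::int. g = c [^] n" if p: "p \<in> carrier H" "g = p \<otimes> c [^] (b :: int)"
    and "(\<exists>a::int. p = c [^] a) \<or> (\<exists>i j. pingpong q (rot q j \<circ> \<pi> p \<circ> rot q i))" for p b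
    using that(3)
  proof (elim disjE exE)
    fix a :: int assume "p = c [^] a"
    then show ?thesis using p by (auto simp: c_pow_mult)
  next
    fix i j assume pp: "pingpong q (rot q j \<circ> \<pi> p \<circ> rot q i)"
    have "p = g \<otimes> c [^] (- b)"
      using p by (simp add: m_assoc c_pow_mult)
    then have "\<pi> p = rot q (k + (int q + 2) * (- b))"
      using g by (simp add: rep_mult rep_c_pow rot_comp del: mult_minus_right)
    then have "rot q j \<circ> \<pi> p \<circ> rot q i = rot q (j + (k + (int q + 2) * (- b)) + i)"
      by (simp add: rot_comp)
    then show ?thesis
      using pingpong_not_rot[OF q_ge_3 pp] by blast
  qed
  note * = this
  have "\<exists>n::int. g = c [^] n"
  proof (cases "even q")
    case True
    then obtain i p b where p: "even_form i p" "g = p \<otimes> c [^] (b :: int)"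
      using even_form_exists g by blast
    show ?thesis
      using even_form_pingpong[OF True p(1)] by (intro *[OF even_form_closed[OF p(1)] p(2)]) blast
  next
    case False
    then obtain p b where p: "odd_form p" "g = p \<otimes> c [^] (b :: int)"
      using odd_form_exists g by blast
    show ?thesis
      using odd_form_pingpong[OF False p(1)]
      by (intro *[OF odd_form_closed[OF p(1)] p(2)]) (metis comp_id rot_0)
  qed
  with that show ?thesis by blast
qed

end

subsection \<open>The presentation\<close>

text \<open>It is used for \<open>a1\<close> and \<open>a2\<close>, for the presented generators
  themselves, and for a pair of homotheties.\<close>

lemma (in group) Gamma1_relations_iff:
  assumes "\<And>z. f z \<in> carrier G"
  shows "(\<forall>(u, w) \<in> Gamma1_relations q. word_val G f u = word_val G f w) \<longleftrightarrow>
    (if even q then (f A1hat \<otimes> f A2hat) [^] (q div 2) = (f A2hat \<otimes> f A1hat) [^] (q div 2)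
     else (f A1hat \<otimes> f A2hat) [^] (q div 2) \<otimes> f A1hat = (f A2hat \<otimes> f A1hat) [^] (q div 2) \<otimes> f A2hat)
    \<and> (f A1hat \<otimes> f A2hat) [^] qtilde q = \<one>"
proof -
  have alt: "word_val G f (alt_word q z z') =
      (if even q then (f z \<otimes> f z') [^] (q div 2) else (f z \<otimes> f z') [^] (q div 2) \<otimes> f z)" for z z'
  proof (cases "even q")
    case True
    then show ?thesis
      using word_val_alt_word(1)[of f "q div 2", OF assms] by simp
  next
    case False
    then show ?thesis
      using word_val_alt_word(2)[of f "q div 2", OF assms] by simp
  qed
  show ?thesis
    unfolding Gamma1_relations_def
    by (simp add: alt word_val_replicate assms)
qed

lemma GLC_comp_left_cancel: "f \<in> carrier GLC \<Longrightarrow> f \<circ> g = f \<circ> h \<Longrightarrow> g = h"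
  by (auto simp: GLC_def fun_eq_iff dest: bij_is_inj injD)

lemma rot_q_mult_comm:
  assumes "q > 0" "f \<in> carrier GLC"
  shows "rot q (int q * n) \<circ> f = f \<circ> rot q (int q * n)"
  using GLC.int_pow_commute[of "rot q (int q)" f n] assms rot_q_comm[of q f]
  by (simp add: rot_int_pow linear_GLC)

lemma rot_nat_pow: "rot q k [^]\<^bsub>GLC\<^esub> (n :: nat) = rot q (k * int n)"
  using rot_int_pow[of q k "int n"] by (simp add: int_pow_int)

lemma a1_a2_pow: "q \<ge> 3 \<Longrightarrow> (a1 q \<circ> a2 q) [^]\<^bsub>GLC\<^esub> (n :: nat) = rot q ((int q + 2) * int n)"
  by (simp add: a1_a2 rot_nat_pow)

text \<open>\<open>qtilde q\<close> is \<open>2 * q\<close> divided by the gcd of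
  \<open>2 * q\<close> and \<open>q + 2\<close>, so it is the order of
  \<open>rot q (int q + 2)\<close>. The gcd is \<open>2\<close>, \<open>4\<close> or
  \<open>1\<close> for \<open>q\<close> congruent to \<open>0\<close>, congruent to \<open>2\<close>
  modulo \<open>4\<close>, or odd.\<close>

lemma two_q_dvd_iff:
  assumes "q > 0"
  shows "2 * int q dvd (int q + 2) * n \<longleftrightarrow> int (qtilde q) dvd n"
proof -
  consider k where "q = 4 * k" | k where "q = 4 * k + 2" | "odd q"
  proof -
    have "q mod 4 = 0 \<or> q mod 4 = 2 \<or> odd q" by presburger
    then show ?thesis
      using that by (metis add.right_neutral mult_div_mod_eq)
  qed
  then show ?thesis
  proof cases
    case (1 k)
    have "coprime (int k) (2 * int k + 1)"
      by (rule coprimeI) (simp add: dvd_add_right_iff)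
    then have "coprime (4 * int k) (2 * int k + 1)"
      using coprime_mult_left_iff[of "2 * 2" "int k" "2 * int k + 1"]
      by (simp add: coprime_mult_left_iff[of 2 2, simplified])
    then have "4 * int k dvd (2 * int k + 1) * n \<longleftrightarrow> 4 * int k dvd n"
      by (rule coprime_dvd_mult_right_iff)
    moreover have "2 * int q dvd (int q + 2) * n \<longleftrightarrow> 2 * (4 * int k) dvd 2 * ((2 * int k + 1) * n)"
      by (simp add: 1 algebra_simps)
    moreover have "qtilde q = 4 * k" by (simp add: 1 qtilde_def)
    ultimately show ?thesis by (simp only: dvd_mult_cancel_left) simp
  next
    case (2 k)
    have "coprime (2 * int k + 1) (int k + 1)"
    proof (rule coprimeI)
      fix d assume "d dvd 2 * int k + 1" "d dvd int k + 1"
      then have "d dvd 2 * (int k + 1) - (2 * int k + 1)" by (intro dvd_diff dvd_mult)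
      then show "is_unit d" by simp
    qed
    then have "2 * int k + 1 dvd (int k + 1) * n \<longleftrightarrow> 2 * int k + 1 dvd n"
      by (rule coprime_dvd_mult_right_iff)
    moreover have "2 * int q dvd (int q + 2) * n \<longleftrightarrow> 4 * (2 * int k + 1) dvd 4 * ((int k + 1) * n)"
      by (simp add: 2 algebra_simps)
    moreover have "int (qtilde q) = 2 * int k + 1"
    proof -
      have "(4 * k + 2) mod 4 = 2" by presburger
      then show ?thesis by (simp add: 2 qtilde_def)
    qed
    ultimately show ?thesis by (simp only: dvd_mult_cancel_left) simp
  next
    case 3
    then have "coprime (int q) 2" by simp
    then have "coprime (int q) (int q + 2)"
      by (simp add: coprime_iff_gcd_eq_1)
    then have "coprime (2 * int q) (int q + 2)"
      using 3 by simp
    then have "2 * int q dvd (int q + 2) * n \<longleftrightarrow> 2 * int q dvd n"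
      by (rule coprime_dvd_mult_right_iff)
    moreover have "qtilde q = 2 * q"
    proof -
      have "q mod 4 \<noteq> 0" "q mod 4 \<noteq> 2" using 3 by presburger+
      then show ?thesis by (simp add: qtilde_def)
    qed
    ultimately show ?thesis by simp
  qed
qed

text \<open>Both sides of the alternating relation are compared after left multiplication by
  \<open>a1 q\<close>, which brings in powers of \<open>a1 q \<circ> a2 q\<close>, that is, known
  rotations.\<close>

lemma a1_a2_relations:
  assumes "q \<ge> 3" "\<And>z. f z = (case z of A1hat \<Rightarrow> a1 q | A2hat \<Rightarrow> a2 q)"
    and "(u, w) \<in> Gamma1_relations q"
  shows "word_val GLC f u = word_val GLC f w"
proof -
  have f: "f A1hat = a1 q" "f A2hat = a2 q" using assms(2) by simp_all
  have cl: "f z \<in> carrier GLC" for z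
    using assms by (cases z) simp_all
  have q: "q > 0" using assms by simp
  have comm: "a1 q \<circ> (a2 q \<circ> a1 q) [^]\<^bsub>GLC\<^esub> n = (a1 q \<circ> a2 q) [^]\<^bsub>GLC\<^esub> n \<circ> a1 q" for n :: nat
    using GLC.alternating_pow_commute[of "a1 q" "a2 q" n] assms by simp
  have "(a1 q \<circ> a2 q) [^]\<^bsub>GLC\<^esub> (q div 2) = (a2 q \<circ> a1 q) [^]\<^bsub>GLC\<^esub> (q div 2)" if even: "even q"
  proof -
    obtain m where m: "q = 2 * m" using even by (rule evenE)
    \<comment> \<open>So the \<open>m\<close>-th power of \<open>a1 q \<circ> a2 q\<close> is
      \<open>1\<close> or \<open>- 1\<close> and commutes with \<open>a1 q\<close>.\<close>
    have "(int q + 2) * int m = int q * (int m + 1)"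
      by (simp add: m algebra_simps)
    then have "a1 q \<circ> (a2 q \<circ> a1 q) [^]\<^bsub>GLC\<^esub> m = a1 q \<circ> (a1 q \<circ> a2 q) [^]\<^bsub>GLC\<^esub> m"
      using rot_q_mult_comm[OF q, of "a1 q" "int m + 1"] assms(1)
      by (simp only: comm a1_a2_pow a_GLC)
    then have "(a2 q \<circ> a1 q) [^]\<^bsub>GLC\<^esub> m = (a1 q \<circ> a2 q) [^]\<^bsub>GLC\<^esub> m"
      by (rule GLC_comp_left_cancel[OF a_GLC(1)[OF assms(1)]])
    then show ?thesis by (simp add: m)
  qed
  moreover have "(a1 q \<circ> a2 q) [^]\<^bsub>GLC\<^esub> (q div 2) \<circ> a1 q = (a2 q \<circ> a1 q) [^]\<^bsub>GLC\<^esub> (q div 2) \<circ> a2 q" if odd: "odd q"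
  proof -
    obtain m where m: "q = 2 * m + 1" using odd by (rule oddE)
    have "a1 q \<circ> ((a2 q \<circ> a1 q) [^]\<^bsub>GLC\<^esub> m \<circ> a2 q) = (a1 q \<circ> a2 q) [^]\<^bsub>GLC\<^esub> m \<circ> (a1 q \<circ> a2 q)"
      by (metis comm comp_assoc)
    also have "\<dots> = rot q ((int q + 2) * int m + (int q + 2))"
      by (simp only: rot_nat_pow a1_a2 assms(1) rot_comp)
    finally have 1: "a1 q \<circ> ((a2 q \<circ> a1 q) [^]\<^bsub>GLC\<^esub> m \<circ> a2 q) = rot q ((int q + 2) * int m + (int q + 2))" .
    have "(a1 q \<circ> a2 q) [^]\<^bsub>GLC\<^esub> m \<circ> a1 q = rot q ((int q + 2) * int m + (int q + 1)) \<circ> vmap q"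
      by (simp only: a1_a2_pow[OF assms(1)]) (simp only: a1_alt[OF assms(1)] rot_comp_assoc)
    \<comment> \<open>The index is a multiple of \<open>q\<close>, so the left side of the relation
      is \<open>v\<close> or \<open>- v\<close>.\<close>
    also have "(int q + 2) * int m + (int q + 1) = int q * (int m + 2)"
      by (simp add: m algebra_simps)
    finally have "a1 q \<circ> ((a1 q \<circ> a2 q) [^]\<^bsub>GLC\<^esub> m \<circ> a1 q) = a1 q \<circ> rot q (int q * (int m + 2)) \<circ> vmap q"
      by (simp only: comp_assoc)
    also have "a1 q \<circ> rot q (int q * (int m + 2)) = rot q (int q * (int m + 2)) \<circ> a1 q"
      using rot_q_mult_comm[OF q, of "a1 q" "int m + 2"] assms(1) by (simp only: a_GLC)
    also have "rot q (int q * (int m + 2)) \<circ> a1 q \<circ> vmap q = rot q (int q * (int m + 2) + (int q + 1) + int q)"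
      by (simp only: a1_alt[OF assms(1)] comp_assoc vmap_vmap[OF assms(1)] rot_comp add.assoc)
    also have "\<dots> = rot q ((int q + 2) * int m + (int q + 2))"
      by (rule rot_cong[OF q]) (simp add: m algebra_simps)
    finally have "a1 q \<circ> ((a1 q \<circ> a2 q) [^]\<^bsub>GLC\<^esub> m \<circ> a1 q) = a1 q \<circ> ((a2 q \<circ> a1 q) [^]\<^bsub>GLC\<^esub> m \<circ> a2 q)"
      by (simp only: 1)
    then have "(a1 q \<circ> a2 q) [^]\<^bsub>GLC\<^esub> m \<circ> a1 q = (a2 q \<circ> a1 q) [^]\<^bsub>GLC\<^esub> m \<circ> a2 q"
      by (rule GLC_comp_left_cancel[OF a_GLC(1)[OF assms(1)]])
    then show ?thesis by (simp add: m)
  qed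
  moreover have "(a1 q \<circ> a2 q) [^]\<^bsub>GLC\<^esub> qtilde q = id"
    by (simp only: a1_a2_pow assms(1) rot_eq_id_iff[OF q] two_q_dvd_iff[OF q] dvd_refl)
  ultimately have "\<forall>(u, w) \<in> Gamma1_relations q. word_val GLC f u = word_val GLC f w"
    unfolding GLC.Gamma1_relations_iff[OF cl] by (simp add: f)
  with assms(3) show ?thesis by blast
qed

abbreviation (input) Gamma1_pres :: "nat \<Rightarrow> gen word set monoid" where
  "Gamma1_pres q \<equiv> presented_group (Gamma1_relations q)"

abbreviation (input) pres_x :: "nat \<Rightarrow> gen word set" where
  "pres_x q \<equiv> pres_gen (Gamma1_relations q) A1hat"

abbreviation (input) pres_y :: "nat \<Rightarrow> gen word set" where
  "pres_y q \<equiv> pres_gen (Gamma1_relations q) A2hat"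

lemma Gamma1_pres_relations:
  "if even q then (pres_x q \<otimes>\<^bsub>Gamma1_pres q\<^esub> pres_y q) [^]\<^bsub>Gamma1_pres q\<^esub> (q div 2)
      = (pres_y q \<otimes>\<^bsub>Gamma1_pres q\<^esub> pres_x q) [^]\<^bsub>Gamma1_pres q\<^esub> (q div 2)
    else (pres_x q \<otimes>\<^bsub>Gamma1_pres q\<^esub> pres_y q) [^]\<^bsub>Gamma1_pres q\<^esub> (q div 2) \<otimes>\<^bsub>Gamma1_pres q\<^esub> pres_x q
      = (pres_y q \<otimes>\<^bsub>Gamma1_pres q\<^esub> pres_x q) [^]\<^bsub>Gamma1_pres q\<^esub> (q div 2) \<otimes>\<^bsub>Gamma1_pres q\<^esub> pres_y q"
  "(pres_x q \<otimes>\<^bsub>Gamma1_pres q\<^esub> pres_y q) [^]\<^bsub>Gamma1_pres q\<^esub> qtilde q = \<one>\<^bsub>Gamma1_pres q\<^esub>"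
proof -
  interpret P: group "Gamma1_pres q" by (rule group_presented_group)
  have "\<forall>(u, w) \<in> Gamma1_relations q. word_val (Gamma1_pres q) (pres_gen (Gamma1_relations q)) u
      = word_val (Gamma1_pres q) (pres_gen (Gamma1_relations q)) w"
    using presented_group_relation by blast
  note this[unfolded P.Gamma1_relations_iff[OF pres_gen_closed]]
  then show "if even q then (pres_x q \<otimes>\<^bsub>Gamma1_pres q\<^esub> pres_y q) [^]\<^bsub>Gamma1_pres q\<^esub> (q div 2)
      = (pres_y q \<otimes>\<^bsub>Gamma1_pres q\<^esub> pres_x q) [^]\<^bsub>Gamma1_pres q\<^esub> (q div 2)
    else (pres_x q \<otimes>\<^bsub>Gamma1_pres q\<^esub> pres_y q) [^]\<^bsub>Gamma1_pres q\<^esub> (q div 2) \<otimes>\<^bsub>Gamma1_pres q\<^esub> pres_x q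
      = (pres_y q \<otimes>\<^bsub>Gamma1_pres q\<^esub> pres_x q) [^]\<^bsub>Gamma1_pres q\<^esub> (q div 2) \<otimes>\<^bsub>Gamma1_pres q\<^esub> pres_y q"
  "(pres_x q \<otimes>\<^bsub>Gamma1_pres q\<^esub> pres_y q) [^]\<^bsub>Gamma1_pres q\<^esub> qtilde q = \<one>\<^bsub>Gamma1_pres q\<^esub>"
    by blast+
qed

text \<open>For injectivity: a kernel element acts as \<open>rot q 0\<close>, hence is some
  \<open>c^n\<close>. The index of its rotation forces \<open>qtilde q\<close> to divide
  \<open>n\<close>, and the second relation makes it trivial.\<close>

lemma Gamma1_rep_exists:
  assumes "q \<ge> 3"
  obtains \<pi> where "braid_rep (Gamma1_pres q) q (pres_x q) (pres_y q) \<pi>"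
    "inj_on \<pi> (carrier (Gamma1_pres q))" "\<pi> ` carrier (Gamma1_pres q) = Gamma1 q"
proof -
  interpret P: group "Gamma1_pres q" by (rule group_presented_group)
  define f where "f = (\<lambda>z. case z of A1hat \<Rightarrow> a1 q | A2hat \<Rightarrow> a2 q)"
  have "f z \<in> carrier GLC" for z
    using assms by (cases z) (simp_all add: f_def)
  then obtain \<pi> where \<pi>: "\<pi> \<in> hom (Gamma1_pres q) GLC" "\<And>z. \<pi> (pres_gen (Gamma1_relations q) z) = f z"
    using a1_a2_relations[of q f] assms
    by (metis (no_types, lifting) GLC.presented_group_hom_exists f_def)
  have "range (pres_gen (Gamma1_relations q)) = {pres_x q, pres_y q}"
  proof (intro equalityI subsetI)
    fix X assume "X \<in> range (pres_gen (Gamma1_relations q))"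
    then obtain z where "X = pres_gen (Gamma1_relations q) z" by blast
    then show "X \<in> {pres_x q, pres_y q}" by (cases z) simp_all
  qed blast
  then have gen: "carrier (Gamma1_pres q) = generate (Gamma1_pres q) {pres_x q, pres_y q}"
    using generate_pres_gen[of "Gamma1_relations q"] by simp
  interpret braid_rep "Gamma1_pres q" q "pres_x q" "pres_y q" \<pi>
    by unfold_locales (use Gamma1_pres_relations[of q] gen \<pi> assms in \<open>simp_all add: f_def generate.incl\<close>)
  have hom: "group_hom (Gamma1_pres q) GLC \<pi>"
    by (intro group_hom.intro group_hom_axioms.intro \<pi> group_GLC P.is_group)
  have "g = \<one>\<^bsub>Gamma1_pres q\<^esub>" if g: "g \<in> carrier (Gamma1_pres q)" "\<pi> g = id" for g
  proof -
    have "\<pi> g = rot q 0" using g by simp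
    with g(1) obtain n :: int where n: "g = c [^]\<^bsub>Gamma1_pres q\<^esub> n"
      by (rule rep_rot_imp_c_pow)
    then have "rot q ((int q + 2) * n) = id" using g rep_c_pow by simp
    then obtain k where "n = int (qtilde q) * k"
      using assms by (auto simp: rot_eq_id_iff two_q_dvd_iff)
    then have "g = (c [^]\<^bsub>Gamma1_pres q\<^esub> qtilde q) [^]\<^bsub>Gamma1_pres q\<^esub> k"
      by (simp add: n P.int_pow_pow flip: int_pow_int)
    also have "\<dots> = \<one>\<^bsub>Gamma1_pres q\<^esub>"
      by (simp add: c_def Gamma1_pres_relations(2))
    finally show ?thesis .
  qed
  then have "inj_on \<pi> (carrier (Gamma1_pres q))"
    by (simp add: group_hom.inj_on_one_iff[OF hom])
  moreover have "\<pi> ` carrier (Gamma1_pres q) = Gamma1 q"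
    unfolding Gamma1_def gen
    by (subst group_hom.generate_img[OF hom, symmetric]) (simp_all add: rep_x rep_y)
  ultimately show ?thesis
    using that braid_rep_axioms by blast
qed

lemma Gamma1_presentation:
  assumes "q \<ge> 3"
  shows "\<exists>\<phi> \<in> iso (grp (Gamma1 q)) (Gamma1_pres q). \<phi> (a1 q) = pres_x q \<and> \<phi> (a2 q) = pres_y q"
proof -
  obtain \<pi> where "braid_rep (Gamma1_pres q) q (pres_x q) (pres_y q) \<pi>"
    and inj: "inj_on \<pi> (carrier (Gamma1_pres q))" and im: "\<pi> ` carrier (Gamma1_pres q) = Gamma1 q"
    using Gamma1_rep_exists[OF assms] .
  then interpret braid_rep "Gamma1_pres q" q "pres_x q" "pres_y q" \<pi> by simp
  have "\<pi> \<in> iso (Gamma1_pres q) (grp (Gamma1 q))"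
    using inj im by (auto simp: iso_def hom_def bij_betw_def rep_mult)
  then have "inv_into (carrier (Gamma1_pres q)) \<pi> \<in> iso (grp (Gamma1 q)) (Gamma1_pres q)"
    by (rule iso_set_sym)
  moreover have "inv_into (carrier (Gamma1_pres q)) \<pi> (a1 q) = pres_x q"
    "inv_into (carrier (Gamma1_pres q)) \<pi> (a2 q) = pres_y q"
    by (simp_all add: inj inv_into_f_eq rep_x rep_y)
  ultimately show ?thesis by blast
qed

text \<open>For even \<open>q\<close> the relations preserve the exponent sum of the first generator minus that of the
  second, which is encoded below by homotheties with factors \<open>2\<close> and \<open>1 / 2\<close>. Since \<open>v\<close> conjugates
  \<open>a1\<close> to \<open>a2\<close>, this is what keeps \<open>v\<close> out of \<open>Gamma1\<close>.\<close>

lemma Gamma1_not_conj_a1_a2: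
  assumes "q \<ge> 3" "even q" "f \<in> Gamma1 q"
  shows "f \<circ> a1 q \<noteq> a2 q \<circ> f"
proof
  assume f: "f \<circ> a1 q = a2 q \<circ> f"
  obtain \<pi> where "braid_rep (Gamma1_pres q) q (pres_x q) (pres_y q) \<pi>"
    and inj: "inj_on \<pi> (carrier (Gamma1_pres q))" and im: "\<pi> ` carrier (Gamma1_pres q) = Gamma1 q"
    using Gamma1_rep_exists[OF assms(1)] .
  then interpret braid_rep "Gamma1_pres q" q "pres_x q" "pres_y q" \<pi> by simp
  obtain g where g: "g \<in> carrier (Gamma1_pres q)" "f = \<pi> g"
    using assms(3) im by blast
  have "\<pi> (g \<otimes>\<^bsub>Gamma1_pres q\<^esub> pres_x q) = \<pi> (pres_y q \<otimes>\<^bsub>Gamma1_pres q\<^esub> g)"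
    using f g by (simp add: rep_mult rep_x rep_y)
  then have gx: "g \<otimes>\<^bsub>Gamma1_pres q\<^esub> pres_x q = pres_y q \<otimes>\<^bsub>Gamma1_pres q\<^esub> g"
    by (rule inj_onD[OF inj]) (simp_all add: g)
  define s where "s = (\<lambda>z. mu (case z of A1hat \<Rightarrow> 2 | A2hat \<Rightarrow> 1 / 2))"
  have cl: "s z \<in> carrier GLC" for z
    by (auto simp: s_def split: gen.split intro!: mu_GLC)
  have "s A1hat \<circ> s A2hat = id" "s A2hat \<circ> s A1hat = id"
    by (auto simp: s_def mu_def)
  then have "\<forall>(u, w) \<in> Gamma1_relations q. word_val GLC s u = word_val GLC s w"
    unfolding GLC.Gamma1_relations_iff[OF cl] using assms(2) GLC.nat_pow_one by simp
  then have "\<And>u w. (u, w) \<in> Gamma1_relations q \<Longrightarrow> word_val GLC s u = word_val GLC s w"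
    by blast
  then obtain \<delta> where \<delta>: "\<delta> \<in> hom (Gamma1_pres q) GLC"
      "\<And>z. \<delta> (pres_gen (Gamma1_relations q) z) = s z"
    using GLC.presented_group_hom_exists[of s, OF cl] by blast
  have "\<delta> g \<circ> s A1hat = s A2hat \<circ> \<delta> g"
    using arg_cong[OF gx, of \<delta>] hom_mult[OF \<delta>(1)] g \<delta>(2) by simp
  moreover have \<delta>g: "\<delta> g \<in> carrier GLC" by (rule hom_in_carrier[OF \<delta>(1) g(1)])
  \<comment> \<open>By linearity \<open>\<delta> g\<close> commutes with the factor
    \<open>2\<close>, so \<open>\<delta> g 1\<close> has to vanish, against injectivity.\<close>
  ultimately have "\<delta> g (2 *\<^sub>R 1) = 1 / 2 * \<delta> g 1"
    by (auto simp: s_def mu_def fun_eq_iff scaleR_conv_of_real dest: spec[of _ 1])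
  then have "2 * \<delta> g 1 = 1 / 2 * \<delta> g 1"
    unfolding linear_cmul[OF linear_GLC[OF \<delta>g]] by (simp add: scaleR_conv_of_real)
  then have "\<delta> g 1 = 0" by simp
  then have "\<delta> g 1 = \<delta> g 0"
    using linear_0[OF linear_GLC[OF \<delta>g]] by simp
  moreover have "inj (\<delta> g)" using \<delta>g by (simp add: GLC_def bij_is_inj)
  ultimately have "(1 :: complex) = 0" by (metis injD)
  then show False by simp
qed

text \<open>Otherwise \<open>- 1\<close> would be the image of some \<open>c^n\<close>, and
  \<open>(q + 2) * n\<close> would agree with \<open>q\<close> modulo \<open>2 * q\<close>; modulo
  \<open>4\<close> this reads \<open>0 = 2\<close>.\<close>

lemma minus_one_notin_Gamma1:
  assumes "q \<ge> 3" "q mod 4 = 2"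
  shows "rot q (int q) \<notin> Gamma1 q"
proof
  assume *: "rot q (int q) \<in> Gamma1 q"
  obtain \<pi> where "braid_rep (Gamma1_pres q) q (pres_x q) (pres_y q) \<pi>"
    and im: "\<pi> ` carrier (Gamma1_pres q) = Gamma1 q"
    using Gamma1_rep_exists[OF assms(1)] .
  then interpret braid_rep "Gamma1_pres q" q "pres_x q" "pres_y q" \<pi> by simp
  obtain g where g: "g \<in> carrier (Gamma1_pres q)" "\<pi> g = rot q (int q)"
    using * im by (metis imageE)
  then obtain n :: int where "g = c [^]\<^bsub>Gamma1_pres q\<^esub> n"
    by (rule rep_rot_imp_c_pow)
  then have "2 * int q dvd (int q + 2) * n - int q"
    using g rep_c_pow q_pos by (simp add: rot_eq_iff)
  moreover obtain k where "q = 4 * k + 2"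
    using assms(2) by (metis mult_div_mod_eq)
  then have "(int q + 2) * n - int q = 4 * ((int k + 1) * n - int k) - 2" "4 dvd 2 * int q"
    by (simp_all add: algebra_simps)
  ultimately have "4 dvd 4 * ((int k + 1) * n - int k) - 2"
    by (metis dvd_trans)
  then show False by presburger
qed

subsection \<open>The stabilizer of 1 and the cosets\<close>

lemma GC_eq_generate:
  assumes "q \<ge> 3"
  shows "GC q = generate GLC {vmap q, a1 q}"
proof -
  have "group_hom (SL2 q) GLC (Psi q)"
    by (intro group_hom.intro group_hom_axioms.intro group_SL2 group_GLC Psi_hom assms)
  from group_hom.generate_img[OF this, of "{V_mat, A1_mat q}"] show ?thesis
    using generators_in_SL2 by (simp add: GC_def Gmat_def vmap_def a1_def)
qed

text \<open>Reduced words in the free product \<open>Z/2 * Z/q\<close>, the classical structure of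
  the Hecke group modulo \<open>- 1\<close>.\<close>

inductive alt_prod :: "nat \<Rightarrow> (complex \<Rightarrow> complex) \<Rightarrow> bool" for q where
  id: "alt_prod q id"
| step: "alt_prod q m \<Longrightarrow> \<not> int q dvd k \<Longrightarrow> alt_prod q (rot q k \<circ> vmap q \<circ> m)"

lemma inv_vmap:
  assumes "q \<ge> 3"
  shows "inv\<^bsub>GLC\<^esub> (vmap q) = rot q (int q) \<circ> vmap q"
proof (rule GLC.inv_equality)
  show "(rot q (int q) \<circ> vmap q) \<otimes>\<^bsub>GLC\<^esub> vmap q = \<one>\<^bsub>GLC\<^esub>"
    using assms by (simp add: comp_assoc vmap_vmap rot_comp rot_eq_id_iff)
qed (use assms in \<open>simp_all add: GLC_comp_closed\<close>)

lemma vmap_a1_a2: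
  assumes "q \<ge> 3"
  shows "vmap q \<circ> a1 q = a2 q \<circ> vmap q" "vmap q \<circ> a2 q = a1 q \<circ> vmap q"
proof -
  show "vmap q \<circ> a1 q = a2 q \<circ> vmap q"
    by (simp add: a1_alt a2_alt assms comp_assoc)
  have "vmap q \<circ> a2 q = rot q (int q) \<circ> rot q (int q + 1)"
    by (simp add: a2_alt vmap_vmap assms flip: comp_assoc)
  also have "\<dots> = rot q (int q + 1) \<circ> rot q (int q)"
    by (simp add: rot_comp add.commute)
  also have "\<dots> = a1 q \<circ> vmap q"
    by (simp add: a1_alt vmap_vmap assms comp_assoc)
  finally show "vmap q \<circ> a2 q = a1 q \<circ> vmap q" .
qed

lemma vmap_rot_q_mult:
  assumes "q \<ge> 3"
  shows "vmap q \<circ> (rot q (int q * n) \<circ> f) = rot q (int q * n) \<circ> (vmap q \<circ> f)"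
  using rot_q_mult_comm[of q "vmap q" n] assms by (simp flip: comp_assoc)

lemma vmap_eq_rot_a1:
  assumes "q \<ge> 3"
  shows "vmap q = rot q (- (int q + 1)) \<circ> a1 q"
  by (simp add: a1_alt assms rot_comp_assoc)

lemma GC_alt_prod:
  assumes "q \<ge> 3" "g \<in> GC q"
  shows "\<exists>a m b. alt_prod q m \<and> g = rot q a \<circ> m \<circ> rot q b"
proof -
  define F where "F = {f. \<exists>a m b. alt_prod q m \<and> f = rot q a \<circ> m \<circ> rot q b}"
  have F_rot: "rot q j \<circ> f \<in> F" if "f \<in> F" for f j
    using that unfolding F_def by (force simp: rot_comp_assoc comp_assoc)
  have F_v: "vmap q \<circ> f \<in> F" if f_in: "f \<in> F" for f
  proof -
    obtain a m b where m: "alt_prod q m" and f: "f = rot q a \<circ> m \<circ> rot q b"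
      using f_in unfolding F_def by blast
    have one: "\<not> int q dvd 1" using assms by auto
    from m show ?thesis
    proof cases
      case id
      \<comment> \<open>A leading \<open>v\<close> is padded to
        \<open>rot q 1 \<circ> vmap q\<close>, since each factor must have an index not divisible by
        \<open>q\<close>.\<close>
      have "vmap q \<circ> f = rot q (- 1) \<circ> (rot q 1 \<circ> vmap q \<circ> id) \<circ> rot q (a + b)"
        by (simp add: f id comp_assoc rot_comp rot_comp_assoc)
      then show ?thesis
        unfolding F_def using alt_prod.step[OF alt_prod.id one] by blast
    next
      case (step m' k)
      show ?thesis
      proof (cases "int q dvd a + k")
        case True
        then obtain n where n: "a + k = int q * n" ..
        have "vmap q \<circ> f = vmap q \<circ> (rot q (int q * n) \<circ> (vmap q \<circ> (m' \<circ> rot q b)))"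
          by (simp add: f step comp_assoc rot_comp_assoc n)
        also have "\<dots> = rot q (int q * n) \<circ> (vmap q \<circ> vmap q) \<circ> (m' \<circ> rot q b)"
          by (simp only: vmap_rot_q_mult[OF assms(1)] comp_assoc)
        also have "\<dots> = rot q (int q * n + int q) \<circ> m' \<circ> rot q b"
          by (simp add: vmap_vmap[OF assms(1)] rot_comp comp_assoc)
        finally show ?thesis
          unfolding F_def using step by blast
      next
        case False
        have "vmap q \<circ> f = rot q (- 1) \<circ> (rot q 1 \<circ> vmap q \<circ> (rot q (a + k) \<circ> vmap q \<circ> m')) \<circ> rot q b"
          by (simp add: f step comp_assoc rot_comp_assoc)
        then show ?thesis
          unfolding F_def using alt_prod.step[OF alt_prod.step[OF step(2) False] one] by blast
      qed
    qed
  qed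
  have "\<forall>f\<in>F. g \<circ> f \<in> F"
  proof (rule GLC.generate_right_induct[of g "{vmap q, a1 q}"])
    show "g \<in> generate GLC {vmap q, a1 q}"
      using assms by (simp add: GC_eq_generate)
  next
    fix s a assume s: "\<forall>f\<in>F. s \<circ> f \<in> F" and a: "a \<in> {vmap q, a1 q}"
    have "inv\<^bsub>GLC\<^esub> (a1 q) = vmap q \<circ> rot q (- 1)" "a1 q = rot q (int q + 1) \<circ> vmap q"
      "inv\<^bsub>GLC\<^esub> (vmap q) = rot q (int q) \<circ> vmap q"
      by (rule inv_a1[OF assms(1)] a1_alt[OF assms(1)] inv_vmap[OF assms(1)])+
    then have "a \<circ> f \<in> F" "inv\<^bsub>GLC\<^esub> a \<circ> f \<in> F" if "f \<in> F" for f
      using a \<open>f \<in> F\<close> by (auto simp: comp_assoc intro!: F_v F_rot)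
    with s show "\<forall>f\<in>F. (s \<otimes>\<^bsub>GLC\<^esub> a) \<circ> f \<in> F" "\<forall>f\<in>F. (s \<otimes>\<^bsub>GLC\<^esub> inv\<^bsub>GLC\<^esub> a) \<circ> f \<in> F"
      by (simp_all add: comp_assoc)
  qed (use assms in auto)
  moreover have "id \<in> F"
    unfolding F_def using alt_prod.id[of q]
    by (intro CollectI exI[of _ 0] exI[of _ id]) simp
  ultimately have "g \<circ> id \<in> F" by blast
  then show ?thesis by (simp add: F_def)
qed

lemma a1_1:
  assumes "q \<ge> 3"
  shows "a1 q 1 = 1"
proof -
  have 1: "psi q (vector [1, 0]) = 1" by (simp add: psi_alt assms)
  have "A1_mat q *v vector [1, 0] = vector [1, 0]"
    by (simp add: A1_mat_def matrix_vector_mult_def vec_eq_iff forall_2 sum_2)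
  then have "a1 q (psi q (vector [1, 0])) = psi q (vector [1, 0])"
    by (simp add: a1_def Psi_psi assms)
  then show ?thesis by (simp add: 1)
qed

lemma a1_pow_1:
  assumes "q \<ge> 3"
  shows "(a1 q [^]\<^bsub>GLC\<^esub> (i :: int)) 1 = 1"
proof -
  have *: "(a1 q [^]\<^bsub>GLC\<^esub> (n :: nat)) 1 = 1" for n
    by (induction n) (simp_all add: a1_1 assms)
  have **: "(inv\<^bsub>GLC\<^esub> (a1 q [^]\<^bsub>GLC\<^esub> n)) 1 = 1" for n :: nat
  proof -
    have "inv\<^bsub>GLC\<^esub> (a1 q [^]\<^bsub>GLC\<^esub> n) \<circ> (a1 q [^]\<^bsub>GLC\<^esub> n) = id"
      using GLC.l_inv[of "a1 q [^]\<^bsub>GLC\<^esub> n"] assms by simp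
    then show ?thesis using * by (metis comp_apply id_apply)
  qed
  show ?thesis
    by (cases "i < 0") (simp_all only: int_pow_def2 if_True if_False * **)
qed

lemma ht_rot_1: "ht q (rot q j 1) = sin (of_int j * pi / real q) * sin (of_int (j + 1) * pi / real q)"
proof -
  have "zeta q * rot q j 1 = rot q (1 + j) 1"
    using fun_cong[OF rot_comp[of q 1 j], of 1] by (simp add: rot_1 mu_def)
  then show ?thesis
    by (simp add: ht_def rot_def mu_def add.commute)
qed

text \<open>In an alternating product applied to a point of the unit circle, every factor \<open>v\<close> that meets a
  point off the boundary of the cone increases the norm. Hence a product that ends on the unit circle
  has only met boundary points, which forces it to be a rotation times a power of \<open>a1\<close>.\<close>

lemma alt_prod_rot_1:
  assumes "q \<ge> 3" "alt_prod q m"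
  shows "0 \<le> ht q (m (rot q b 1)) \<and> 1 \<le> cmod (m (rot q b 1)) \<and>
    (cmod (m (rot q b 1)) \<le> 1 \<longrightarrow> (\<exists>j i. m \<circ> rot q b = rot q j \<circ> a1 q [^]\<^bsub>GLC\<^esub> (i :: int)))"
  using assms(2)
proof induction
  case id
  have "id \<circ> rot q b = rot q b \<circ> a1 q [^]\<^bsub>GLC\<^esub> (0 :: int)" by simp
  moreover have "0 \<le> ht q (id (rot q b 1)) \<and> 1 \<le> cmod (id (rot q b 1))"
    unfolding id_apply ht_rot_1 using sin_consecutive_nonneg[of q b] assms(1) by simp
  ultimately show ?case by blast
next
  case (step m k)
  define w where "w = m (rot q b 1)"
  define K where "K = 2 * lam q / (sin (pi / real q))\<^sup>2"
  have K: "K > 0"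
    using lam_pos[of q] sin_pi_div_pos[of q] assms(1) by (simp add: K_def)
  have norm: "(cmod (vmap q w))\<^sup>2 = (cmod w)\<^sup>2 + K * ht q w"
    unfolding K_def by (rule norm_vmap[OF assms(1)])
  have w: "0 \<le> ht q w" "1 \<le> cmod w"
    using step.IH by (simp_all add: w_def)
  then have Kw: "0 \<le> K * ht q w" "1 \<le> (cmod w)\<^sup>2"
    using K by (simp_all add: one_le_power)
  have "0 \<le> ht q (rot q k (vmap q w))"
    by (rule ht_rot_vmap(1)[OF assms(1) w(1) step.hyps(2)])
  moreover have "1\<^sup>2 \<le> (cmod (vmap q w))\<^sup>2"
    unfolding norm using Kw by simp
  then have "1 \<le> cmod (vmap q w)"
    by (rule power2_le_imp_le) simp
  moreover have "\<exists>j i. rot q k \<circ> vmap q \<circ> m \<circ> rot q b = rot q j \<circ> a1 q [^]\<^bsub>GLC\<^esub> (i :: int)"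
    if le: "cmod (vmap q w) \<le> 1"
  proof -
    have "(cmod (vmap q w))\<^sup>2 \<le> 1" using le by (simp add: power_le_one)
    then have "(cmod w)\<^sup>2 \<le> 1" "K * ht q w = 0"
      using Kw unfolding norm by linarith+
    then have "cmod w \<le> 1" and ht0: "ht q w = 0"
      using K by (auto simp: abs_square_le_1)
    then obtain j i where ji: "m \<circ> rot q b = rot q j \<circ> a1 q [^]\<^bsub>GLC\<^esub> (i :: int)"
      using step.IH unfolding w_def by blast
    have "w = rot q j 1"
      using fun_cong[OF ji, of 1] by (simp add: w_def a1_pow_1 assms(1))
    with ht0 consider "int q dvd j" | "int q dvd j + 1"
      using assms(1) sin_int_eq_0_iff[of q] by (auto simp: ht_rot_1 simp del: of_int_add)
    then show ?thesis
    proof cases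
      \<comment> \<open>The point \<open>w\<close> is \<open>1\<close> or \<open>- 1\<close>, and
        rewriting \<open>v\<close> by \<open>vmap_eq_rot_a1\<close> raises the exponent of
        \<open>a1 q\<close> by one.\<close>
      case 1
      then obtain n where n: "j = int q * n" ..
      have "a1 q \<circ> a1 q [^]\<^bsub>GLC\<^esub> i = a1 q [^]\<^bsub>GLC\<^esub> (1 + i)"
        using GLC.int_pow_mult[of "a1 q" 1 i] assms(1) by simp
      then have va: "vmap q \<circ> a1 q [^]\<^bsub>GLC\<^esub> i = rot q (- (int q + 1)) \<circ> a1 q [^]\<^bsub>GLC\<^esub> (1 + i)"
        by (subst vmap_eq_rot_a1[OF assms(1)]) (simp only: comp_assoc)
      have "rot q k \<circ> vmap q \<circ> m \<circ> rot q b
          = rot q (k + (int q * n + - (int q + 1))) \<circ> a1 q [^]\<^bsub>GLC\<^esub> (1 + i)"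
        by (simp only: comp_assoc ji n vmap_rot_q_mult[OF assms(1)] va rot_comp_assoc)
      then show ?thesis by blast
    next
      \<comment> \<open>The point \<open>w\<close> lies on the other edge of the cone, and
        \<open>v\<close> with \<open>rot q (- 1)\<close> forms the inverse of \<open>a1 q\<close>,
        lowering the exponent.\<close>
      case 2
      then obtain n where n: "j + 1 = int q * n" ..
      have "inv\<^bsub>GLC\<^esub> (a1 q) \<circ> a1 q [^]\<^bsub>GLC\<^esub> i = a1 q [^]\<^bsub>GLC\<^esub> (- 1 + i)"
        using GLC.int_pow_mult[of "a1 q" "- 1" i] assms(1) by (simp add: GLC.int_pow_neg)
      then have *: "vmap q \<circ> (rot q (- 1) \<circ> a1 q [^]\<^bsub>GLC\<^esub> i) = a1 q [^]\<^bsub>GLC\<^esub> (- 1 + i)"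
        by (simp add: inv_a1 assms(1) comp_assoc)
      have "rot q j = rot q (int q * n) \<circ> rot q (- 1)"
        using n by (simp add: rot_comp) (simp flip: n)
      then have "rot q k \<circ> vmap q \<circ> m \<circ> rot q b
          = rot q k \<circ> (vmap q \<circ> (rot q (int q * n) \<circ> (rot q (- 1) \<circ> a1 q [^]\<^bsub>GLC\<^esub> i)))"
        by (simp only: comp_assoc ji)
      also have "\<dots> = rot q (k + int q * n) \<circ> a1 q [^]\<^bsub>GLC\<^esub> (- 1 + i)"
        by (simp only: vmap_rot_q_mult[OF assms(1)] *) (simp only: rot_comp_assoc)
      finally show ?thesis by blast
    qed
  qed
  ultimately show ?case unfolding w_def comp_apply norm_rot by blast
qed

text \<open>As \<open>g 1\<close> has norm \<open>1\<close>, \<open>alt_prod_rot_1\<close> makes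
  \<open>g\<close> a rotation times a power of \<open>a1 q\<close>. That power fixes
  \<open>1\<close>, so the rotation does too and is the identity.\<close>

lemma GC_stabilizer_1:
  assumes "q \<ge> 3" "g \<in> GC q" "g 1 = 1"
  shows "\<exists>i::int. g = a1 q [^]\<^bsub>GLC\<^esub> i"
proof -
  obtain a m b where m: "alt_prod q m" and g: "g = rot q a \<circ> m \<circ> rot q b"
    using GC_alt_prod assms by blast
  have "cmod (m (rot q b 1)) = cmod (g 1)" by (simp add: g)
  then obtain j i where ji: "m \<circ> rot q b = rot q j \<circ> a1 q [^]\<^bsub>GLC\<^esub> (i :: int)"
    using alt_prod_rot_1[OF assms(1) m, of b] assms(3) by auto
  then have g': "g = rot q (a + j) \<circ> a1 q [^]\<^bsub>GLC\<^esub> i"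
    by (simp add: g comp_assoc rot_comp_assoc)
  then have "rot q (a + j) 1 = 1"
    using assms(3) by (simp add: a1_pow_1 assms(1))
  then have "rot q (a + j) = id" by (simp add: rot_def mu_def fun_eq_iff)
  with g' show ?thesis by auto
qed

text \<open>Applied with \<open>t = vmap q\<close> in \<open>GC q\<close> and with
  \<open>t = rot q 1\<close> in the cyclic group of rotations. Two listed powers of \<open>t\<close>
  in one coset would put a power with exponent strictly between \<open>0\<close> and
  \<open>n\<close> into \<open>N\<close>.\<close>

lemma (in group) subgroup_index_cyclic:
  assumes "subgroup K G" "subgroup N G" "t \<in> K" "N \<subseteq> K"
    and cover: "\<And>g. g \<in> K \<Longrightarrow> \<exists>h\<in>N. \<exists>i<n. g = h \<otimes> t [^] (i :: nat)"
    and notin: "\<And>i. 0 < i \<Longrightarrow> i < n \<Longrightarrow> t [^] i \<notin> N"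
  shows "subgroup_index (G\<lparr>carrier := K\<rparr>) N = n"
proof -
  have t: "t \<in> carrier G" using assms subgroup.subset by blast
  have tK: "t [^] i \<in> K" for i :: nat
    using assms(1,3) by (induction i) (auto intro: subgroup.m_closed subgroup.one_closed)
  have coset: "r_coset (G\<lparr>carrier := K\<rparr>) N = r_coset G N"
    by (simp add: r_coset_def fun_eq_iff)
  have "N #> g \<in> (\<lambda>i. N #> t [^] i) ` {..<n}" if "g \<in> K" for g
  proof -
    obtain h i where h: "h \<in> N" "i < n" "g = h \<otimes> t [^] i" using cover[OF \<open>g \<in> K\<close>] by blast
    then have "N #> g = N #> h #> t [^] i"
      using assms(2) t by (simp add: coset_mult_assoc subgroup.subset subgroup.mem_carrier)
    also have "N #> h = N"
      using assms(2) h by (simp add: coset_join2 subgroup.mem_carrier)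
    finally show ?thesis using h by blast
  qed
  then have "rcosets\<^bsub>G\<lparr>carrier := K\<rparr>\<^esub> N = (\<lambda>i. N #> t [^] i) ` {..<n}"
    using tK by (auto simp: RCOSETS_def coset)
  moreover have False if ij: "i < j" "j < n" "N #> t [^] i = N #> t [^] j" for i j :: nat
  proof -
    have "t [^] j \<in> N #> t [^] j"
      using assms(2) t by (intro rcos_self) auto
    then obtain h where h: "h \<in> N" "t [^] j = h \<otimes> t [^] i"
      using ij by (auto simp: r_coset_def)
    have "t [^] (j - i) \<otimes> t [^] i = t [^] j"
      using t ij by (simp add: nat_pow_mult)
    then have "t [^] (j - i) = h"
      using h t assms(2) by (metis nat_pow_closed right_cancel subgroup.mem_carrier)
    moreover have "0 < j - i" "j - i < n" using ij by auto
    ultimately show False using notin h(1) by blast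
  qed
  then have "inj_on (\<lambda>i. N #> t [^] i) {..<n}"
    by (intro inj_onI) (metis lessThan_iff linorder_neqE_nat)
  ultimately show ?thesis
    by (simp add: subgroup_index_def card_image)
qed

section \<open>Normality of \<open>Gamma1\<close> and representatives of its cosets\<close>

lemma subgroup_Gamma1: "q \<ge> 3 \<Longrightarrow> subgroup (Gamma1 q) GLC"
  unfolding Gamma1_def by (rule GLC.generate_is_subgroup) auto

lemma subgroup_GC: "q \<ge> 3 \<Longrightarrow> subgroup (GC q) GLC"
  unfolding GC_eq_generate by (rule GLC.generate_is_subgroup) auto

lemma Gamma1_comp: "q \<ge> 3 \<Longrightarrow> f \<in> Gamma1 q \<Longrightarrow> g \<in> Gamma1 q \<Longrightarrow> f \<circ> g \<in> Gamma1 q"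
  using subgroup.m_closed[OF subgroup_Gamma1] by simp

lemma GC_comp: "q \<ge> 3 \<Longrightarrow> f \<in> GC q \<Longrightarrow> g \<in> GC q \<Longrightarrow> f \<circ> g \<in> GC q"
  using subgroup.m_closed[OF subgroup_GC] by simp

lemma a_in_Gamma1: "a1 q \<in> Gamma1 q" "a2 q \<in> Gamma1 q"
  by (simp_all add: Gamma1_def generate.incl)

lemma vmap_in_GC: "q \<ge> 3 \<Longrightarrow> vmap q \<in> GC q"
  by (simp add: GC_eq_generate generate.incl)

lemma Gamma1_subset_GC:
  assumes "q \<ge> 3"
  shows "Gamma1 q \<subseteq> GC q"
proof -
  have a1: "a1 q \<in> GC q"
    by (simp add: GC_eq_generate[OF assms] generate.incl)
  have "a2 q = vmap q \<circ> a1 q \<circ> inv\<^bsub>GLC\<^esub> (vmap q)"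
    using GLC.m_assoc[of "a2 q" "vmap q" "inv\<^bsub>GLC\<^esub> (vmap q)"] GLC.r_inv[of "vmap q"] assms
    by (simp add: vmap_a1_a2)
  then have "a2 q \<in> GC q"
    using assms a1 by (metis GC_comp subgroup.m_inv_closed subgroup_GC vmap_in_GC)
  with a1 show ?thesis
    unfolding Gamma1_def using subgroup_GC[OF assms]
    by (intro GLC.generate_subgroup_incl) auto
qed

text \<open>Conjugation by \<open>v\<close> swaps \<open>a1\<close> and \<open>a2\<close>, hence
  normalizes the group that they generate.\<close>

lemma vmap_conj_Gamma1:
  assumes "q \<ge> 3" "h \<in> Gamma1 q"
  shows "\<exists>h'\<in>Gamma1 q. vmap q \<circ> h = h' \<circ> vmap q"
proof (rule GLC.generate_right_induct[of h "{a1 q, a2 q}"])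
  show "h \<in> generate GLC {a1 q, a2 q}"
    using assms(2) by (simp add: Gamma1_def)
  have "id \<in> Gamma1 q"
    using subgroup.one_closed[OF subgroup_Gamma1[OF assms(1)]] by simp
  then show "\<exists>h'\<in>Gamma1 q. vmap q \<circ> \<one>\<^bsub>GLC\<^esub> = h' \<circ> vmap q"
    by (intro bexI[of _ id]) simp_all
  fix s a assume s: "\<exists>h'\<in>Gamma1 q. vmap q \<circ> s = h' \<circ> vmap q" and a: "a \<in> {a1 q, a2 q}"
  then obtain h' where h': "h' \<in> Gamma1 q" "vmap q \<circ> s = h' \<circ> vmap q" by blast
  obtain b where b: "b \<in> Gamma1 q" "vmap q \<circ> a = b \<circ> vmap q" "b \<in> carrier GLC" "a \<in> carrier GLC"
    using a vmap_a1_a2[OF assms(1)] a_in_Gamma1 a_GLC[OF assms(1)] by (metis insertE singletonD)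
  have "h' \<circ> b \<in> Gamma1 q" by (intro Gamma1_comp assms h' b)
  moreover have "vmap q \<circ> (s \<circ> a) = h' \<circ> b \<circ> vmap q"
    using h' b by (metis comp_assoc)
  ultimately show "\<exists>h'\<in>Gamma1 q. vmap q \<circ> (s \<otimes>\<^bsub>GLC\<^esub> a) = h' \<circ> vmap q" by auto
  have "inv\<^bsub>GLC\<^esub> b \<circ> b = id" "a \<circ> inv\<^bsub>GLC\<^esub> a = id"
    using GLC.l_inv[OF b(3)] GLC.r_inv[OF b(4)] by simp_all
  then have "vmap q \<circ> inv\<^bsub>GLC\<^esub> a = inv\<^bsub>GLC\<^esub> b \<circ> vmap q"
    using b(2) by (metis comp_assoc comp_id id_comp)
  then have "vmap q \<circ> (s \<circ> inv\<^bsub>GLC\<^esub> a) = h' \<circ> inv\<^bsub>GLC\<^esub> b \<circ> vmap q"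
    using h' by (metis comp_assoc)
  moreover have "h' \<circ> inv\<^bsub>GLC\<^esub> b \<in> Gamma1 q"
    using subgroup.m_inv_closed[OF subgroup_Gamma1[OF assms(1)] b(1)] by (intro Gamma1_comp assms h')
  ultimately show "\<exists>h'\<in>Gamma1 q. vmap q \<circ> (s \<otimes>\<^bsub>GLC\<^esub> inv\<^bsub>GLC\<^esub> a) = h' \<circ> vmap q" by auto
qed (use assms in auto)

lemma vmap_pow_conj_Gamma1:
  assumes "q \<ge> 3" "h \<in> Gamma1 q"
  shows "\<exists>h'\<in>Gamma1 q. vmap q [^]\<^bsub>GLC\<^esub> (i :: nat) \<circ> h = h' \<circ> vmap q [^]\<^bsub>GLC\<^esub> i"
  using assms(2)
proof (induction i arbitrary: h)
  case (Suc i)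
  obtain h' where h': "h' \<in> Gamma1 q" "vmap q \<circ> h = h' \<circ> vmap q"
    using vmap_conj_Gamma1[OF assms(1) Suc.prems] by blast
  obtain h'' where h'': "h'' \<in> Gamma1 q"
    "vmap q [^]\<^bsub>GLC\<^esub> i \<circ> h' = h'' \<circ> vmap q [^]\<^bsub>GLC\<^esub> i"
    using Suc.IH[OF h'(1)] by blast
  have "vmap q [^]\<^bsub>GLC\<^esub> Suc i \<circ> h = h'' \<circ> vmap q [^]\<^bsub>GLC\<^esub> Suc i"
    using h' h'' by simp (metis comp_assoc)
  then show ?case using h'' by blast
qed auto

lemma GC_decomposition:
  assumes "q \<ge> 3" "g \<in> GC q"
  shows "\<exists>h\<in>Gamma1 q. \<exists>i::nat. g = h \<circ> vmap q [^]\<^bsub>GLC\<^esub> i"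
proof (rule GLC.generate_right_induct[of g "{vmap q, a1 q}"])
  show "g \<in> generate GLC {vmap q, a1 q}"
    using assms by (simp add: GC_eq_generate)
  have "\<one>\<^bsub>GLC\<^esub> = id \<circ> vmap q [^]\<^bsub>GLC\<^esub> (0 :: nat)" "id \<in> Gamma1 q"
    using subgroup.one_closed[OF subgroup_Gamma1[OF assms(1)]] by simp_all
  then show "\<exists>h\<in>Gamma1 q. \<exists>i::nat. \<one>\<^bsub>GLC\<^esub> = h \<circ> vmap q [^]\<^bsub>GLC\<^esub> i" by blast
  fix s a assume "\<exists>h\<in>Gamma1 q. \<exists>i::nat. s = h \<circ> vmap q [^]\<^bsub>GLC\<^esub> i" and a: "a \<in> {vmap q, a1 q}"
  then obtain h and i :: nat where h: "h \<in> Gamma1 q" and s: "s = h \<circ> vmap q [^]\<^bsub>GLC\<^esub> i" by blast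
  have v: "\<exists>h\<in>Gamma1 q. \<exists>i::nat. s \<circ> vmap q [^]\<^bsub>GLC\<^esub> j = h \<circ> vmap q [^]\<^bsub>GLC\<^esub> i" for j :: nat
  proof -
    have "s \<circ> vmap q [^]\<^bsub>GLC\<^esub> j = h \<circ> vmap q [^]\<^bsub>GLC\<^esub> (i + j)"
      using GLC.nat_pow_mult[of "vmap q" i j] assms(1) by (simp add: s comp_assoc)
    then show ?thesis using h by blast
  qed
  have v1: "vmap q [^]\<^bsub>GLC\<^esub> (1 :: nat) = vmap q" by simp
  \<comment> \<open>\<open>v\<close> has order four, so its inverse is \<open>v^3\<close> and the
    exponents stay natural numbers.\<close>
  have v3: "vmap q [^]\<^bsub>GLC\<^esub> (3 :: nat) = inv\<^bsub>GLC\<^esub> (vmap q)"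
    using assms(1) by (simp add: numeral_3_eq_3 inv_vmap vmap_vmap)
  have \<Gamma>: "\<exists>h\<in>Gamma1 q. \<exists>i::nat. s \<circ> b = h \<circ> vmap q [^]\<^bsub>GLC\<^esub> i" if "b \<in> Gamma1 q" for b
  proof -
    obtain b' where "b' \<in> Gamma1 q" "vmap q [^]\<^bsub>GLC\<^esub> i \<circ> b = b' \<circ> vmap q [^]\<^bsub>GLC\<^esub> i"
      using vmap_pow_conj_Gamma1[OF assms(1) \<open>b \<in> Gamma1 q\<close>] by blast
    then have "s \<circ> b = h \<circ> b' \<circ> vmap q [^]\<^bsub>GLC\<^esub> i" "h \<circ> b' \<in> Gamma1 q"
      using h assms(1) by (auto simp: s comp_assoc intro: Gamma1_comp)
    then show ?thesis by blast
  qed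
  have "inv\<^bsub>GLC\<^esub> (a1 q) \<in> Gamma1 q"
    by (rule subgroup.m_inv_closed[OF subgroup_Gamma1[OF assms(1)] a_in_Gamma1(1)])
  then show "\<exists>h\<in>Gamma1 q. \<exists>i::nat. s \<otimes>\<^bsub>GLC\<^esub> a = h \<circ> vmap q [^]\<^bsub>GLC\<^esub> i"
    "\<exists>h\<in>Gamma1 q. \<exists>i::nat. s \<otimes>\<^bsub>GLC\<^esub> inv\<^bsub>GLC\<^esub> a = h \<circ> vmap q [^]\<^bsub>GLC\<^esub> i"
    using a v[of 1, unfolded v1] v[of 3, unfolded v3] \<Gamma>[OF a_in_Gamma1(1)] \<Gamma>[of "inv\<^bsub>GLC\<^esub> (a1 q)"]
    by auto
qed (use assms in auto)

lemma Gamma1_normal: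
  assumes "q \<ge> 3"
  shows "Gamma1 q \<lhd> grp (GC q)"
proof -
  interpret K: group "grp (GC q)"
    by (rule GLC.subgroup_imp_group[OF subgroup_GC[OF assms]])
  have "subgroup (Gamma1 q) (grp (GC q))"
    by (intro GLC.subgroup_incl subgroup_Gamma1 subgroup_GC Gamma1_subset_GC assms)
  moreover have "g \<circ> h \<circ> inv\<^bsub>grp (GC q)\<^esub> g \<in> Gamma1 q" if g: "g \<in> GC q" and h: "h \<in> Gamma1 q" for g h
  proof -
    obtain k i where k: "k \<in> Gamma1 q" "g = k \<circ> vmap q [^]\<^bsub>GLC\<^esub> (i :: nat)"
      using GC_decomposition[OF assms g] by blast
    obtain h' where h': "h' \<in> Gamma1 q" "vmap q [^]\<^bsub>GLC\<^esub> i \<circ> h = h' \<circ> vmap q [^]\<^bsub>GLC\<^esub> i"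
      using vmap_pow_conj_Gamma1[OF assms h] by blast
    have kG: "k \<in> carrier GLC" "h' \<in> carrier GLC" "g \<in> carrier GLC"
      using k(1) h'(1) g subgroup.mem_carrier[OF subgroup_Gamma1[OF assms]] subgroup.mem_carrier[OF subgroup_GC[OF assms]] by auto
    have "inv\<^bsub>GLC\<^esub> k \<circ> k = id" "g \<circ> inv\<^bsub>GLC\<^esub> g = id"
      using GLC.l_inv[OF kG(1)] GLC.r_inv[OF kG(3)] by simp_all
    moreover have "g \<circ> h = k \<circ> h' \<circ> inv\<^bsub>GLC\<^esub> k \<circ> g"
      using h' calculation(1) unfolding k(2) by (metis comp_assoc comp_id id_comp)
    ultimately have "g \<circ> h \<circ> inv\<^bsub>GLC\<^esub> g = k \<circ> h' \<circ> inv\<^bsub>GLC\<^esub> k"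
      by (simp add: comp_assoc)
    moreover have "k \<circ> h' \<circ> inv\<^bsub>GLC\<^esub> k \<in> Gamma1 q"
      using k h' subgroup.m_inv_closed[OF subgroup_Gamma1[OF assms]] by (intro Gamma1_comp assms) auto
    ultimately show ?thesis
      using GLC.m_inv_consistent[OF subgroup_GC[OF assms] g] by simp
  qed
  ultimately show ?thesis
    by (simp add: K.normal_inv_iff)
qed

subsection \<open>Rotations and orbits\<close>

lemma rot_Gamma1_add: "q \<ge> 3 \<Longrightarrow> rot q j \<in> Gamma1 q \<Longrightarrow> rot q k \<in> Gamma1 q \<Longrightarrow> rot q (j + k) \<in> Gamma1 q"
  using Gamma1_comp[of q "rot q j" "rot q k"] by (simp add: rot_comp)

lemma rot_Gamma1_mult: "q \<ge> 3 \<Longrightarrow> rot q k \<in> Gamma1 q \<Longrightarrow> rot q (k * n) \<in> Gamma1 q"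
  using GLC.subgroup_int_pow_closed[OF subgroup_Gamma1, of q "rot q k" n] by (simp add: rot_int_pow)

lemma rot_Gamma1_base: "q \<ge> 3 \<Longrightarrow> rot q ((int q + 2) * n) \<in> Gamma1 q"
  using Gamma1_comp[OF _ a_in_Gamma1, of q] by (intro rot_Gamma1_mult) (simp_all add: a1_a2)

text \<open>\<open>- 1\<close> is an explicit power of \<open>a1 a2\<close>: with exponent
  \<open>q / 2\<close> if \<open>4\<close> divides \<open>q\<close>, and with exponent
  \<open>q\<close> if \<open>q\<close> is odd. Combined with \<open>a1 a2 = - r^2\<close> it yields
  \<open>r^2\<close>.\<close>

lemma rot_q_2_in_Gamma1:
  assumes "q \<ge> 3" "q mod 4 \<noteq> 2"
  shows "rot q (int q) \<in> Gamma1 q" "rot q 2 \<in> Gamma1 q"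
proof -
  have q: "q > 0" using assms by simp
  show *: "rot q (int q) \<in> Gamma1 q"
  proof (cases "even q")
    case True
    then have "4 dvd q" using assms(2) by presburger
    then obtain k where k: "q = 4 * k" ..
    have "2 * int q dvd (int q + 2) * (2 * int k) - int q"
      by (rule dvdI[of _ _ "int k"]) (simp add: k algebra_simps)
    then show ?thesis
      using rot_Gamma1_base[OF assms(1), of "2 * int k"] rot_cong[OF q] by metis
  next
    case False
    then obtain k where k: "q = 2 * k + 1" by (rule oddE)
    have "2 * int q dvd (int q + 2) * int q - int q"
      by (rule dvdI[of _ _ "int k + 1"]) (simp add: k algebra_simps)
    then show ?thesis
      using rot_Gamma1_base[OF assms(1), of "int q"] rot_cong[OF q] by metis
  qed
  show "rot q 2 \<in> Gamma1 q"
    using rot_Gamma1_add[OF assms(1) rot_Gamma1_base[OF assms(1), of 1]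
        rot_Gamma1_mult[OF assms(1) *, of "- 1"]] by simp
qed

lemma vmap_notin_Gamma1:
  assumes "q \<ge> 3" "even q"
  shows "vmap q \<notin> Gamma1 q" "rot q (int q) \<circ> vmap q \<notin> Gamma1 q"
proof -
  show "vmap q \<notin> Gamma1 q"
    using Gamma1_not_conj_a1_a2[OF assms] vmap_a1_a2[OF assms(1)] by blast
  have "rot q (int q) \<circ> vmap q \<circ> a1 q = a2 q \<circ> (rot q (int q) \<circ> vmap q)"
    using rot_q_comm[of q "a2 q"] assms(1) vmap_a1_a2[OF assms(1)]
    by (metis a_GLC(2) comp_assoc less_le_trans linear_GLC zero_less_numeral)
  then show "rot q (int q) \<circ> vmap q \<notin> Gamma1 q"
    using Gamma1_not_conj_a1_a2[OF assms] by blast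
qed

text \<open>Composed with \<open>a1 q\<close>, the two rotations become \<open>- v\<close> and
  \<open>v\<close>.\<close>

lemma rot_notin_Gamma1:
  assumes "q \<ge> 3" "even q"
  shows "rot q (- 1) \<notin> Gamma1 q" "rot q (- (int q + 1)) \<notin> Gamma1 q"
proof -
  have "rot q (- (int q + 1)) \<circ> a1 q = vmap q"
    using vmap_eq_rot_a1[OF assms(1)] by simp
  then show "rot q (- (int q + 1)) \<notin> Gamma1 q"
    using vmap_notin_Gamma1[OF assms] Gamma1_comp[OF assms(1) _ a_in_Gamma1(1)] by metis
  have "rot q (- 1) \<circ> a1 q = rot q (int q) \<circ> vmap q"
    by (simp add: a1_alt assms rot_comp_assoc)
  then show "rot q (- 1) \<notin> Gamma1 q"
    using vmap_notin_Gamma1[OF assms] Gamma1_comp[OF assms(1) _ a_in_Gamma1(1)] by metis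
qed

lemma rot_in_Gamma1_iff_0:
  assumes "q \<ge> 3" "q mod 4 = 0"
  shows "rot q k \<in> Gamma1 q \<longleftrightarrow> 2 dvd k"
proof
  have ev: "rot q j \<in> Gamma1 q" if "even j" for j
    using that rot_Gamma1_mult[OF assms(1) rot_q_2_in_Gamma1(2)] assms by (auto elim!: evenE)
  show "2 dvd k \<Longrightarrow> rot q k \<in> Gamma1 q" by (rule ev)
  assume k: "rot q k \<in> Gamma1 q"
  show "2 dvd k"
  proof (rule ccontr)
    assume "odd k"
    then have "rot q (k + (- 1 - k)) \<in> Gamma1 q"
      by (intro rot_Gamma1_add assms k ev) auto
    moreover have "even q" using assms(2) by presburger
    ultimately show False using rot_notin_Gamma1(1) assms(1) by simp
  qed
qed

text \<open>\<open>rot q 4\<close> is the square of \<open>a1 a2\<close>. The rotations known to lie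
  outside have indices \<open>q\<close>, \<open>- 1\<close> and \<open>- (q + 1)\<close>, which
  cover the residues \<open>2\<close>, \<open>3\<close> and \<open>1\<close> modulo
  \<open>4\<close>.\<close>

lemma rot_in_Gamma1_iff_2:
  assumes "q \<ge> 3" "q mod 4 = 2"
  shows "rot q k \<in> Gamma1 q \<longleftrightarrow> 4 dvd k"
proof
  have q: "even q" "int q mod 4 = 2" using assms(2) by presburger+
  have "2 * int q dvd (int q + 2) * 2 - 4" by simp
  then have "rot q 4 \<in> Gamma1 q"
    using rot_Gamma1_base[OF assms(1), of 2] rot_cong[of q "(int q + 2) * 2" 4] assms(1) by simp
  then have 4: "rot q j \<in> Gamma1 q" if "4 dvd j" for j
    using that rot_Gamma1_mult[OF assms(1)] by (metis dvd_def)
  show "4 dvd k \<Longrightarrow> rot q k \<in> Gamma1 q" by (rule 4)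
  assume k: "rot q k \<in> Gamma1 q"
  have notin: "\<not> 4 dvd j - k" if "rot q j \<notin> Gamma1 q" for j
  proof
    assume "4 dvd j - k"
    then have "rot q (k + (j - k)) \<in> Gamma1 q" by (intro rot_Gamma1_add assms k 4)
    with that show False by simp
  qed
  have "\<not> 4 dvd int q - k" "\<not> 4 dvd - 1 - k" "\<not> 4 dvd - (int q + 1) - k"
    using notin minus_one_notin_Gamma1[OF assms] rot_notin_Gamma1[OF assms(1) q(1)] by blast+
  with q(2) show "4 dvd k" by presburger
qed

lemma generate_mu_zeta_pow:
  assumes "q \<ge> 3"
  shows "generate GLC {mu (zeta q ^ n)} = range (\<lambda>i. rot q (int n * i))"
  using GLC.generate_pow[of "rot q (int n)"] by (auto simp: rot_nat[symmetric] rot_int_pow)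

lemma rotations_in_Gamma1:
  assumes "q \<ge> 3" "n > 0" and iff: "\<And>k. rot q k \<in> Gamma1 q \<longleftrightarrow> int n dvd k"
  shows "generate GLC {mu (zeta q)} \<inter> Gamma1 q = generate GLC {mu (zeta q ^ n)}"
    and "subgroup_index (grp (generate GLC {mu (zeta q)})) (generate GLC {mu (zeta q)} \<inter> Gamma1 q) = n"
proof -
  have gen: "generate GLC {mu (zeta q)} = range (rot q)"
    using generate_mu_zeta_pow[OF assms(1), of 1] by simp
  show "generate GLC {mu (zeta q)} \<inter> Gamma1 q = generate GLC {mu (zeta q ^ n)}"
    unfolding generate_mu_zeta_pow[OF assms(1)] gen using iff by (auto elim!: dvdE)
  have K: "subgroup (range (rot q)) GLC"
    unfolding gen[symmetric] by (rule GLC.generate_is_subgroup) (simp flip: rot_1)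
  have pow: "rot q 1 [^]\<^bsub>GLC\<^esub> (i :: nat) = rot q (int i)" for i
    by (simp add: rot_nat_pow)
  show "subgroup_index (grp (generate GLC {mu (zeta q)})) (generate GLC {mu (zeta q)} \<inter> Gamma1 q) = n"
    unfolding gen
  proof (rule GLC.subgroup_index_cyclic[OF K, where t = "rot q 1"])
    show "subgroup (range (rot q) \<inter> Gamma1 q) GLC"
      by (intro GLC.subgroups_Inter_pair K subgroup_Gamma1 assms)
    fix g assume "g \<in> range (rot q)"
    then obtain k where "g = rot q k" by blast
    then have g: "g = rot q (int n * (k div int n)) \<circ> rot q (int (nat (k mod int n)))"
      using assms(2) by (simp add: rot_comp)
    have "rot q (int n * (k div int n)) \<in> range (rot q) \<inter> Gamma1 q" using iff by simp
    moreover have "nat (k mod int n) < n" using assms(2) by (simp add: nat_less_iff)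
    ultimately show "\<exists>h\<in>range (rot q) \<inter> Gamma1 q. \<exists>i<n. g = h \<otimes>\<^bsub>GLC\<^esub> rot q 1 [^]\<^bsub>GLC\<^esub> i"
      unfolding pow mult_GLC using g by blast
  next
    fix i assume "0 < i" "i < n"
    then show "rot q 1 [^]\<^bsub>GLC\<^esub> i \<notin> range (rot q) \<inter> Gamma1 q"
      unfolding pow using iff by (auto simp: zdvd_not_zless)
  qed auto
qed

section \<open>Orbits of \<open>Gamma1\<close> and its index\<close>

lemma GC_decomposition_less:
  assumes "q \<ge> 3" "g \<in> GC q" "n > 0" "vmap q [^]\<^bsub>GLC\<^esub> (n :: nat) \<in> Gamma1 q"
  shows "\<exists>h\<in>Gamma1 q. \<exists>i<n. g = h \<circ> vmap q [^]\<^bsub>GLC\<^esub> i"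
proof -
  obtain h and i :: nat where h: "h \<in> Gamma1 q" "g = h \<circ> vmap q [^]\<^bsub>GLC\<^esub> i"
    using GC_decomposition assms by blast
  have v: "vmap q \<in> carrier GLC" using assms(1) by simp
  have "vmap q [^]\<^bsub>GLC\<^esub> i = vmap q [^]\<^bsub>GLC\<^esub> (n * (i div n)) \<otimes>\<^bsub>GLC\<^esub> vmap q [^]\<^bsub>GLC\<^esub> (i mod n)"
    by (simp only: GLC.nat_pow_mult[OF v] mult_div_mod_eq)
  moreover have "vmap q [^]\<^bsub>GLC\<^esub> (n * (i div n)) \<in> Gamma1 q"
    using GLC.subgroup_int_pow_closed[OF subgroup_Gamma1[OF assms(1)] assms(4), of "int (i div n)"]
    by (simp add: int_pow_int GLC.nat_pow_pow[OF v])
  ultimately have "g = (h \<circ> vmap q [^]\<^bsub>GLC\<^esub> (n * (i div n))) \<circ> vmap q [^]\<^bsub>GLC\<^esub> (i mod n)"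
      "h \<circ> vmap q [^]\<^bsub>GLC\<^esub> (n * (i div n)) \<in> Gamma1 q"
    using h assms(1) by (simp_all add: comp_assoc Gamma1_comp)
  moreover have "i mod n < n" using assms(3) by simp
  ultimately show ?thesis by blast
qed

lemma vmap_pow_in_GC: "q \<ge> 3 \<Longrightarrow> vmap q [^]\<^bsub>GLC\<^esub> (i :: nat) \<in> GC q"
  using GLC.subgroup_int_pow_closed[OF subgroup_GC vmap_in_GC, of q "int i"] by (simp add: int_pow_int)

lemma Delta1_eq_orbits:
  assumes "q \<ge> 3" "n > 0" "vmap q [^]\<^bsub>GLC\<^esub> (n :: nat) \<in> Gamma1 q"
  shows "Delta1 q = (\<Union>i<n. orb (Gamma1 q) ((vmap q [^]\<^bsub>GLC\<^esub> i) 1))"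
proof (intro equalityI subsetI)
  fix z assume "z \<in> Delta1 q"
  then obtain g where "g \<in> GC q" "z = g 1" by (auto simp: Delta1_def orb_def)
  moreover from this obtain h i where "h \<in> Gamma1 q" "i < n" "g = h \<circ> vmap q [^]\<^bsub>GLC\<^esub> i"
    using GC_decomposition_less[OF assms(1) _ assms(2,3)] by blast
  ultimately show "z \<in> (\<Union>i<n. orb (Gamma1 q) ((vmap q [^]\<^bsub>GLC\<^esub> i) 1))"
    by (auto simp: orb_def)
next
  fix z assume "z \<in> (\<Union>i<n. orb (Gamma1 q) ((vmap q [^]\<^bsub>GLC\<^esub> i) 1))"
  then obtain h i where "h \<in> Gamma1 q" "z = (h \<circ> vmap q [^]\<^bsub>GLC\<^esub> (i :: nat)) 1"
    by (auto simp: orb_def)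
  moreover from this have "h \<circ> vmap q [^]\<^bsub>GLC\<^esub> i \<in> GC q"
    using Gamma1_subset_GC[OF assms(1)] by (intro GC_comp vmap_pow_in_GC assms) auto
  ultimately show "z \<in> Delta1 q" unfolding Delta1_def orb_def by blast
qed

text \<open>A common point gives an element \<open>f\<close> of \<open>GC q\<close> that fixes
  \<open>1\<close>, hence a power of \<open>a1 q\<close> and an element of \<open>Gamma1 q\<close>.
  Moving \<open>f\<close> past \<open>v^j\<close> by normality then puts \<open>v^(j - i)\<close>
  into \<open>Gamma1 q\<close>.\<close>

lemma Gamma1_orbits_disjoint:
  assumes "q \<ge> 3" and notin: "\<And>i::nat. 0 < i \<Longrightarrow> i < n \<Longrightarrow> vmap q [^]\<^bsub>GLC\<^esub> i \<notin> Gamma1 q"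
    and ij: "i < j" "j < n"
  shows "orb (Gamma1 q) ((vmap q [^]\<^bsub>GLC\<^esub> i) 1) \<inter> orb (Gamma1 q) ((vmap q [^]\<^bsub>GLC\<^esub> j) 1) = {}"
proof (rule ccontr)
  note \<Gamma> = subgroup_Gamma1[OF assms(1)]
  define v where "v = (\<lambda>i::nat. vmap q [^]\<^bsub>GLC\<^esub> i)"
  assume "\<not> ?thesis"
  then obtain h h' where h: "h \<in> Gamma1 q" "h' \<in> Gamma1 q" "h (v i 1) = h' (v j 1)"
    by (auto simp: orb_def v_def)
  have vG: "v k \<in> carrier GLC" for k using assms(1) by (simp add: v_def)
  have hG: "h \<in> carrier GLC" "h' \<in> carrier GLC"
    using h subgroup.mem_carrier[OF \<Gamma>] by auto
  define f where "f = inv\<^bsub>GLC\<^esub> (h' \<circ> v j) \<circ> (h \<circ> v i)"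
  have inG: "h' \<circ> v j \<in> GC q" "h \<circ> v i \<in> GC q"
    using h Gamma1_subset_GC[OF assms(1)] by (auto simp: v_def intro!: GC_comp vmap_pow_in_GC assms)
  have hv: "h' \<circ> v j \<in> carrier GLC" by (intro GLC_comp_closed hG vG)
  have "f \<in> GC q"
    unfolding f_def by (intro GC_comp subgroup.m_inv_closed[OF subgroup_GC] inG assms)
  moreover have "f 1 = 1"
    using fun_cong[OF GLC.l_inv[OF hv, simplified], of 1] h(3) by (simp add: f_def)
  ultimately obtain e :: int where "f = a1 q [^]\<^bsub>GLC\<^esub> e"
    using GC_stabilizer_1[OF assms(1)] by blast
  then have "f \<in> Gamma1 q"
    using GLC.subgroup_int_pow_closed[OF \<Gamma> a_in_Gamma1(1)] by simp
  then obtain f' where f': "f' \<in> Gamma1 q" "v j \<circ> f = f' \<circ> v j"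
    using vmap_pow_conj_Gamma1[OF assms(1)] unfolding v_def by blast
  have "h' \<circ> v j \<circ> inv\<^bsub>GLC\<^esub> (h' \<circ> v j) = id"
    using GLC.r_inv[OF hv] by simp
  then have "h \<circ> v i = h' \<circ> v j \<circ> f"
    unfolding f_def by (metis comp_assoc id_comp)
  also have "\<dots> = h' \<circ> f' \<circ> v j"
    using f' by (simp add: comp_assoc)
  also have "v j = v (j - i) \<circ> v i"
    using GLC.nat_pow_mult[of "vmap q" "j - i" i] assms(1) ij by (simp add: v_def)
  finally have "h \<otimes>\<^bsub>GLC\<^esub> v i = (h' \<circ> f' \<circ> v (j - i)) \<otimes>\<^bsub>GLC\<^esub> v i"
    by (simp only: mult_GLC comp_assoc)
  moreover have f'G: "f' \<in> carrier GLC" using f' subgroup.mem_carrier[OF \<Gamma>] by blast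
  ultimately have "h = (h' \<circ> f') \<circ> v (j - i)"
    using hG vG by (subst (asm) GLC.right_cancel) (auto intro!: GLC_comp_closed)
  moreover have hf: "h' \<circ> f' \<in> Gamma1 q" by (intro Gamma1_comp assms h f')
  have "inv\<^bsub>GLC\<^esub> (h' \<circ> f') \<circ> (h' \<circ> f') = id"
    using GLC.l_inv[of "h' \<circ> f'"] subgroup.mem_carrier[OF \<Gamma> hf] by simp
  ultimately have "v (j - i) = inv\<^bsub>GLC\<^esub> (h' \<circ> f') \<circ> h"
    by (metis comp_assoc id_comp)
  then have "v (j - i) \<in> Gamma1 q"
    using subgroup.m_inv_closed[OF \<Gamma> hf] h assms(1) by (simp add: Gamma1_comp)
  with notin[of "j - i"] ij show False by (simp add: v_def)
qed

lemma Gamma1_index: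
  assumes "q \<ge> 3" "n > 0" "vmap q [^]\<^bsub>GLC\<^esub> (n :: nat) \<in> Gamma1 q"
    and "\<And>i. 0 < i \<Longrightarrow> i < n \<Longrightarrow> vmap q [^]\<^bsub>GLC\<^esub> i \<notin> Gamma1 q"
  shows "subgroup_index (grp (GC q)) (Gamma1 q) = n"
proof (rule GLC.subgroup_index_cyclic[where t = "vmap q"])
  show "\<exists>h\<in>Gamma1 q. \<exists>i<n. g = h \<otimes>\<^bsub>GLC\<^esub> vmap q [^]\<^bsub>GLC\<^esub> i" if "g \<in> GC q" for g
    using GC_decomposition_less[OF assms(1) that assms(2,3)] by simp
qed (use assms in \<open>simp_all add: subgroup_GC subgroup_Gamma1 vmap_in_GC Gamma1_subset_GC\<close>)

lemma vmap_1:
  assumes "q \<ge> 3"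
  shows "vmap q 1 = zeta q ^ (q - 1)"
proof -
  have "psi q (vector [1, 0]) = 1" by (simp add: psi_alt assms)
  then show ?thesis
    unfolding zeta_power_pred[OF assms] using vmap_psi[OF assms, of "vector [1, 0]"] by simp
qed

lemma vmap_powers:
  assumes "q \<ge> 3"
  shows "vmap q [^]\<^bsub>GLC\<^esub> (1 :: nat) = vmap q" "vmap q [^]\<^bsub>GLC\<^esub> (2 :: nat) = rot q (int q)"
    "vmap q [^]\<^bsub>GLC\<^esub> (3 :: nat) = rot q (int q) \<circ> vmap q" "vmap q [^]\<^bsub>GLC\<^esub> (4 :: nat) = id"
proof -
  have *: "vmap q [^]\<^bsub>GLC\<^esub> Suc n = vmap q [^]\<^bsub>GLC\<^esub> n \<circ> vmap q" for n :: nat by simp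
  show 1: "vmap q [^]\<^bsub>GLC\<^esub> (1 :: nat) = vmap q" by simp
  show 2: "vmap q [^]\<^bsub>GLC\<^esub> (2 :: nat) = rot q (int q)"
    using *[of 1] 1 vmap_vmap[OF assms] by (simp add: numeral_2_eq_2)
  show 3: "vmap q [^]\<^bsub>GLC\<^esub> (3 :: nat) = rot q (int q) \<circ> vmap q"
    using *[of 2] 2 by (simp add: numeral_3_eq_3 numeral_2_eq_2)
  have "vmap q [^]\<^bsub>GLC\<^esub> (4 :: nat) = rot q (int q) \<circ> (vmap q \<circ> vmap q)"
    using *[of 3] unfolding 3 by (simp add: comp_assoc)
  also have "\<dots> = id" using assms by (simp add: vmap_vmap rot_comp rot_eq_id_iff)
  finally show "vmap q [^]\<^bsub>GLC\<^esub> (4 :: nat) = id" .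
qed

section \<open>The cases \<open>q\<close> odd, \<open>q\<close> divisible by four, and
  \<open>q\<close> congruent to two modulo four\<close>

lemma Gamma1_odd:
  assumes "q \<ge> 3" "odd q"
  shows "Gamma1 q = GC q \<and> mu (-1) \<in> Gamma1 q"
proof -
  have q: "q mod 4 \<noteq> 2" using assms(2) by presburger
  obtain k where k: "q = 2 * k + 1" using assms(2) by (rule oddE)
  \<comment> \<open>\<open>v\<close> is \<open>a1 q\<close> preceded by a rotation of index
    \<open>- (q + 1)\<close>; for odd \<open>q\<close> this index is even, so powers of
    \<open>rot q 2\<close> supply the rotation.\<close>
  have "rot q (2 * - (int k + 1)) \<in> Gamma1 q"
    by (intro rot_Gamma1_mult rot_q_2_in_Gamma1 assms q)
  also have "2 * - (int k + 1) = - (int q + 1)" by (simp add: k)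
  finally have "vmap q \<in> Gamma1 q"
    by (subst vmap_eq_rot_a1[OF assms(1)]) (intro Gamma1_comp a_in_Gamma1 assms)
  then have "GC q \<subseteq> Gamma1 q"
    unfolding GC_eq_generate[OF assms(1)]
    using subgroup_Gamma1[OF assms(1)] a_in_Gamma1(1) by (intro GLC.generate_subgroup_incl) auto
  then show ?thesis
    using Gamma1_subset_GC[OF assms(1)] rot_q_2_in_Gamma1(1)[OF assms(1) q] assms(1)
    by (auto simp: rot_q)
qed

lemma Gamma1_mod_4_eq_0:
  assumes "q \<ge> 3" "q mod 4 = 0"
  shows "Gamma1 q \<lhd> grp (GC q)
      \<and> subgroup_index (grp (GC q)) (Gamma1 q) = 2
      \<and> mu (-1) \<in> Gamma1 q
      \<and> generate GLC {mu (zeta q)} \<inter> Gamma1 q = generate GLC {mu (zeta q ^ 2)}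
      \<and> subgroup_index (grp (generate GLC {mu (zeta q)}))
          (generate GLC {mu (zeta q)} \<inter> Gamma1 q) = 2
      \<and> Delta1 q = orb (Gamma1 q) 1 \<union> orb (Gamma1 q) (zeta q ^ (q - 1))
      \<and> orb (Gamma1 q) 1 \<inter> orb (Gamma1 q) (zeta q ^ (q - 1)) = {}"
proof -
  have q: "q mod 4 \<noteq> 2" "even q" using assms(2) by presburger+
  note v = vmap_powers[OF assms(1)]
  have minus: "rot q (int q) \<in> Gamma1 q" by (rule rot_q_2_in_Gamma1(1)[OF assms(1) q(1)])
  then have in_\<Gamma>: "vmap q [^]\<^bsub>GLC\<^esub> (2 :: nat) \<in> Gamma1 q" by (simp add: v)
  have notin: "vmap q [^]\<^bsub>GLC\<^esub> i \<notin> Gamma1 q" if "0 < i" "i < 2" for i :: nat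
  proof -
    have "i = 1" using that by simp
    then show ?thesis using v(1) vmap_notin_Gamma1(1)[OF assms(1) q(2)] by metis
  qed
  have disj: "orb (Gamma1 q) ((vmap q [^]\<^bsub>GLC\<^esub> i) 1) \<inter> orb (Gamma1 q) ((vmap q [^]\<^bsub>GLC\<^esub> j) 1) = {}"
    if "i < j" "j < 2" for i j :: nat
    using Gamma1_orbits_disjoint[of q 2 i j] notin that assms(1) by blast
  have index: "subgroup_index (grp (GC q)) (Gamma1 q) = 2"
    using Gamma1_index[of q 2] in_\<Gamma> notin assms(1) by simp
  have "{..<2} = {0, 1 :: nat}" by auto
  then have "Delta1 q = orb (Gamma1 q) 1 \<union> orb (Gamma1 q) (zeta q ^ (q - 1))"
    using Delta1_eq_orbits[OF assms(1) _ in_\<Gamma>] v(1) vmap_1[OF assms(1)] by simp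
  moreover have "orb (Gamma1 q) 1 \<inter> orb (Gamma1 q) (zeta q ^ (q - 1)) = {}"
    using disj[of 0 1] v(1) vmap_1[OF assms(1)] by simp
  moreover have "mu (-1) \<in> Gamma1 q"
    using minus assms(1) by (simp add: rot_q)
  moreover have "rot q k \<in> Gamma1 q \<longleftrightarrow> int 2 dvd k" for k
    using rot_in_Gamma1_iff_0[OF assms] by simp
  ultimately show ?thesis
    using Gamma1_normal[OF assms(1)] index
      rotations_in_Gamma1[OF assms(1), of 2] by simp
qed

lemma Gamma1_mod_4_eq_2:
  assumes "q \<ge> 3" "q mod 4 = 2"
  shows "Gamma1 q \<lhd> grp (GC q)
      \<and> subgroup_index (grp (GC q)) (Gamma1 q) = 4
      \<and> mu (-1) \<notin> Gamma1 q
      \<and> generate GLC {mu (zeta q)} \<inter> Gamma1 q = generate GLC {mu (zeta q ^ 4)}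
      \<and> subgroup_index (grp (generate GLC {mu (zeta q)}))
          (generate GLC {mu (zeta q)} \<inter> Gamma1 q) = 4
      \<and> Delta1 q = orb (Gamma1 q) 1 \<union> orb (Gamma1 q) (-1)
                 \<union> orb (Gamma1 q) (zeta q ^ (q - 1)) \<union> orb (Gamma1 q) (- (zeta q ^ (q - 1)))
      \<and> orb (Gamma1 q) 1 \<inter> orb (Gamma1 q) (-1) = {}
      \<and> orb (Gamma1 q) 1 \<inter> orb (Gamma1 q) (zeta q ^ (q - 1)) = {}
      \<and> orb (Gamma1 q) 1 \<inter> orb (Gamma1 q) (- (zeta q ^ (q - 1))) = {}
      \<and> orb (Gamma1 q) (-1) \<inter> orb (Gamma1 q) (zeta q ^ (q - 1)) = {}
      \<and> orb (Gamma1 q) (-1) \<inter> orb (Gamma1 q) (- (zeta q ^ (q - 1))) = {}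
      \<and> orb (Gamma1 q) (zeta q ^ (q - 1)) \<inter> orb (Gamma1 q) (- (zeta q ^ (q - 1))) = {}"
proof -
  have q: "even q" "q > 0" using assms by presburger+
  note v = vmap_powers[OF assms(1)]
  have minus: "rot q (int q) \<notin> Gamma1 q" by (rule minus_one_notin_Gamma1[OF assms])
  have in_\<Gamma>: "vmap q [^]\<^bsub>GLC\<^esub> (4 :: nat) \<in> Gamma1 q"
    using subgroup.one_closed[OF subgroup_Gamma1[OF assms(1)]] by (simp add: v)
  have notin: "vmap q [^]\<^bsub>GLC\<^esub> i \<notin> Gamma1 q" if "0 < i" "i < 4" for i :: nat
  proof -
    have "i = 1 \<or> i = 2 \<or> i = 3" using that by arith
    then show ?thesis using v vmap_notin_Gamma1[OF assms(1) q(1)] minus by metis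
  qed
  have disj: "orb (Gamma1 q) ((vmap q [^]\<^bsub>GLC\<^esub> i) 1) \<inter> orb (Gamma1 q) ((vmap q [^]\<^bsub>GLC\<^esub> j) 1) = {}"
    if "i < j" "j < 4" for i j :: nat
    using Gamma1_orbits_disjoint[of q 4 i j] notin that assms(1) by blast
  have index: "subgroup_index (grp (GC q)) (Gamma1 q) = 4"
    using Gamma1_index[of q 4] in_\<Gamma> notin assms(1) by simp
  have v_1: "(vmap q [^]\<^bsub>GLC\<^esub> (0 :: nat)) 1 = 1" "(vmap q [^]\<^bsub>GLC\<^esub> (1 :: nat)) 1 = zeta q ^ (q - 1)"
    "(vmap q [^]\<^bsub>GLC\<^esub> (2 :: nat)) 1 = - 1" "(vmap q [^]\<^bsub>GLC\<^esub> (3 :: nat)) 1 = - (zeta q ^ (q - 1))"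
    unfolding v using q by (simp_all add: vmap_1 assms rot_q_z)
  have "{..<4} = {0, 1, 2, 3 :: nat}" by auto
  then have Delta: "Delta1 q = orb (Gamma1 q) 1 \<union> orb (Gamma1 q) (-1)
                 \<union> orb (Gamma1 q) (zeta q ^ (q - 1)) \<union> orb (Gamma1 q) (- (zeta q ^ (q - 1)))"
    using Delta1_eq_orbits[OF assms(1) _ in_\<Gamma>] by (simp only: v_1 UN_insert UN_empty Un_ac) simp
  have "orb (Gamma1 q) 1 \<inter> orb (Gamma1 q) (zeta q ^ (q - 1)) = {}"
    "orb (Gamma1 q) 1 \<inter> orb (Gamma1 q) (- 1) = {}"
    "orb (Gamma1 q) 1 \<inter> orb (Gamma1 q) (- (zeta q ^ (q - 1))) = {}"
    "orb (Gamma1 q) (zeta q ^ (q - 1)) \<inter> orb (Gamma1 q) (- 1) = {}"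
    "orb (Gamma1 q) (zeta q ^ (q - 1)) \<inter> orb (Gamma1 q) (- (zeta q ^ (q - 1))) = {}"
    "orb (Gamma1 q) (- 1) \<inter> orb (Gamma1 q) (- (zeta q ^ (q - 1))) = {}"
    using disj[of 0 1] disj[of 0 2] disj[of 0 3] disj[of 1 2] disj[of 1 3] disj[of 2 3]
    unfolding v_1 by simp_all
  moreover have "mu (-1) \<notin> Gamma1 q"
    using minus q by (simp add: rot_q)
  moreover have "rot q k \<in> Gamma1 q \<longleftrightarrow> int 4 dvd k" for k
    using rot_in_Gamma1_iff_2[OF assms] by simp
  ultimately show ?thesis
    using Gamma1_normal[OF assms(1)] index
      rotations_in_Gamma1[OF assms(1), of 4] Delta by (simp add: Int_commute)
qed

theorem theorem9p2:
  fixes q :: nat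
  assumes "q \<ge> 3"
  shows
    "(odd q \<longrightarrow>
        Gamma1 q = GC q \<and> mu (-1) \<in> Gamma1 q)
   \<and> (q mod 4 = 0 \<longrightarrow>
        Gamma1 q \<lhd> grp (GC q)
      \<and> subgroup_index (grp (GC q)) (Gamma1 q) = 2
      \<and> mu (-1) \<in> Gamma1 q
      \<and> generate GLC {mu (zeta q)} \<inter> Gamma1 q = generate GLC {mu (zeta q ^ 2)}
      \<and> subgroup_index (grp (generate GLC {mu (zeta q)}))
          (generate GLC {mu (zeta q)} \<inter> Gamma1 q) = 2
      \<and> Delta1 q = orb (Gamma1 q) 1 \<union> orb (Gamma1 q) (zeta q ^ (q - 1))
      \<and> orb (Gamma1 q) 1 \<inter> orb (Gamma1 q) (zeta q ^ (q - 1)) = {})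
   \<and> (q mod 4 = 2 \<longrightarrow>
        Gamma1 q \<lhd> grp (GC q)
      \<and> subgroup_index (grp (GC q)) (Gamma1 q) = 4
      \<and> mu (-1) \<notin> Gamma1 q
      \<and> generate GLC {mu (zeta q)} \<inter> Gamma1 q = generate GLC {mu (zeta q ^ 4)}
      \<and> subgroup_index (grp (generate GLC {mu (zeta q)}))
          (generate GLC {mu (zeta q)} \<inter> Gamma1 q) = 4
      \<and> Delta1 q = orb (Gamma1 q) 1 \<union> orb (Gamma1 q) (-1)
                 \<union> orb (Gamma1 q) (zeta q ^ (q - 1)) \<union> orb (Gamma1 q) (- (zeta q ^ (q - 1)))
      \<and> orb (Gamma1 q) 1 \<inter> orb (Gamma1 q) (-1) = {}
      \<and> orb (Gamma1 q) 1 \<inter> orb (Gamma1 q) (zeta q ^ (q - 1)) = {}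
      \<and> orb (Gamma1 q) 1 \<inter> orb (Gamma1 q) (- (zeta q ^ (q - 1))) = {}
      \<and> orb (Gamma1 q) (-1) \<inter> orb (Gamma1 q) (zeta q ^ (q - 1)) = {}
      \<and> orb (Gamma1 q) (-1) \<inter> orb (Gamma1 q) (- (zeta q ^ (q - 1))) = {}
      \<and> orb (Gamma1 q) (zeta q ^ (q - 1)) \<inter> orb (Gamma1 q) (- (zeta q ^ (q - 1))) = {})
   \<and> (\<exists>\<phi> \<in> iso (grp (Gamma1 q)) (presented_group (Gamma1_relations q)).
        \<phi> (a1 q) = pres_gen (Gamma1_relations q) A1hat
      \<and> \<phi> (a2 q) = pres_gen (Gamma1_relations q) A2hat)"
  using Gamma1_odd[OF assms] Gamma1_mod_4_eq_0[OF assms] Gamma1_mod_4_eq_2[OF assms]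
    Gamma1_presentation[OF assms] by blast

end
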